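(* There exists an absolute constant $C$ such that for every function $p=p(n)$ with $\frac{6\log(n)}{n}<p(n)\le 1$, the random graph $G=G(n,p)$ almost surely satisfies $$\mathrm{ch}_2(G)\le \mathrm{ch}(G)+C,$$ that is, the probability that $\mathrm{ch}_2(G(n,p(n)))\le \mathrm{ch}(G(n,p(n)))+C$ tends to $1$ as $n\to\infty$.
   Context: $\log$ is the natural logarithm. $G(n,p)$ is the binomial random graph on $n$ labelled vertices, where each pair of distinct vertices is an edge independently with probability $p$. "Almost surely" means with probability tending to $1$ as $n\to\infty$. $N_G(v)$ is the set of neighbors of $v$ and $d_G(v)=|N_G(v)|$. The choice number $\mathrm{ch}(G)$ is the least $k$ such that for every assignment of sets (lists) $L(v)$ with $|L(v)|\ge k$ to the vertices $v\in V(G)$ there is a proper coloring $f$ of $G$ with $f(v)\in L(v)$ for all $v$. A $2$-dynamic coloring of $G$ is a proper coloring $f$ such that $|f(N_G(v))|\ge\min\{2,d_G(v)\}$ for every vertex $v$. The $2$-dynamic choosability $\mathrm{ch}_2(G)$ is the least positive integer $k$ such that for every assignment of lists $L(v)$ with $|L(v)|\ge k$ to the vertices $v\in V(G)$ there is a $2$-dynamic coloring $f$ of $G$ with $f(v)\in L(v)$ for all $v\in V(G)$. *)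

theory Defs
  imports "HOL-Probability.Probability"
begin

record 'v graph =
  verts :: "'v set"
  edges :: "'v set set"

definition simple_graph :: "'v graph \<Rightarrow> bool" where
  "simple_graph G \<longleftrightarrow> finite (verts G) \<and> (\<forall>e\<in>edges G. e \<subseteq> verts G \<and> card e = 2)"

definition nbrs :: "'v graph \<Rightarrow> 'v \<Rightarrow> 'v set" where
  "nbrs G v = {u \<in> verts G. {u, v} \<in> edges G}"

definition degree :: "'v graph \<Rightarrow> 'v \<Rightarrow> nat" where
  "degree G v = card (nbrs G v)"

definition proper_coloring :: "'v graph \<Rightarrow> ('v \<Rightarrow> 'c) \<Rightarrow> bool" where
  "proper_coloring G f \<longleftrightarrow> (\<forall>u\<in>verts G. \<forall>v\<in>verts G. {u, v} \<in> edges G \<longrightarrow> f u \<noteq> f v)"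

definition two_dynamic_coloring :: "'v graph \<Rightarrow> ('v \<Rightarrow> 'c) \<Rightarrow> bool" where
  "two_dynamic_coloring G f \<longleftrightarrow>
     proper_coloring G f \<and> (\<forall>v\<in>verts G. card (f ` nbrs G v) \<ge> min 2 (degree G v))"

text \<open>
  Colours are natural numbers. On a finite graph every list may be cut down to a finite one, so
  only finitely many colours matter and any infinite set of colours gives the same notion.
  Infinite lists count as having at least \<open>k\<close> elements; they are treated separately because
  \<^const>\<open>card\<close> is 0 on infinite sets.
\<close>

definition lists_of_size_ge :: "'v graph \<Rightarrow> nat \<Rightarrow> ('v \<Rightarrow> nat set) \<Rightarrow> bool" where
  "lists_of_size_ge G k L \<longleftrightarrow> (\<forall>v\<in>verts G. infinite (L v) \<or> card (L v) \<ge> k)"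

definition choosable :: "'v graph \<Rightarrow> nat \<Rightarrow> bool" where
  "choosable G k \<longleftrightarrow> (\<forall>L. lists_of_size_ge G k L \<longrightarrow>
     (\<exists>f. proper_coloring G f \<and> (\<forall>v\<in>verts G. f v \<in> L v)))"

definition two_dynamic_choosable :: "'v graph \<Rightarrow> nat \<Rightarrow> bool" where
  "two_dynamic_choosable G k \<longleftrightarrow> (\<forall>L. lists_of_size_ge G k L \<longrightarrow>
     (\<exists>f. two_dynamic_coloring G f \<and> (\<forall>v\<in>verts G. f v \<in> L v)))"

definition ch :: "'v graph \<Rightarrow> nat" where
  "ch G = (LEAST k. choosable G k)"

definition ch2 :: "'v graph \<Rightarrow> nat" where
  "ch2 G = (LEAST k. 0 < k \<and> two_dynamic_choosable G k)"

definition vertex_pairs :: "nat \<Rightarrow> nat set set" where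
  "vertex_pairs n = {e. e \<subseteq> {..<n} \<and> card e = 2}"

text \<open>
  One independent coin per pair of distinct vertices. \<^const>\<open>bernoulli_pmf\<close> clamps its
  parameter to the unit interval.
\<close>

definition random_graph :: "nat \<Rightarrow> real \<Rightarrow> nat graph pmf" where
  "random_graph n p =
     map_pmf (\<lambda>b. \<lparr>verts = {..<n}, edges = {e \<in> vertex_pairs n. b e}\<rparr>)
       (Pi_pmf (vertex_pairs n) False (\<lambda>_. bernoulli_pmf p))"

lemma simple_graph_random_graph: "G \<in> set_pmf (random_graph n p) \<Longrightarrow> simple_graph G"
  by (auto simp: random_graph_def simple_graph_def vertex_pairs_def)

text \<open>
  The minima defining \<^const>\<open>ch\<close> and \<^const>\<open>ch2\<close> are over nonempty sets: if the lists are as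
  large as the vertex set, all vertices can be given different colours.
\<close>

lemma injective_choice:
  assumes "finite W" "\<forall>v\<in>W. infinite (L v) \<or> card (L v) \<ge> card W"
  shows "\<exists>f. inj_on f W \<and> (\<forall>v\<in>W. f v \<in> L v)"
proof -
  have "\<exists>f. inj_on f U \<and> (\<forall>v\<in>U. f v \<in> L v)" if "finite U" "U \<subseteq> W" for U
    using that
  proof (induction U rule: finite_induct)
    case empty
    show ?case by simp
  next
    case (insert x U)
    then obtain f where f: "inj_on f U" "\<forall>v\<in>U. f v \<in> L v" by auto
    have "card (insert x U) \<le> card W"
      using insert.prems assms(1) by (rule card_mono[rotated])
    hence less: "card (f ` U) < card W"
      using insert.hyps card_image_le[of U f] by simp
    have "\<not> L x \<subseteq> f ` U"
    proof
      assume sub: "L x \<subseteq> f ` U"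
      hence "finite (L x)" "card (L x) \<le> card (f ` U)"
        using insert.hyps by (auto intro: finite_subset card_mono)
      with less assms(2) insert.prems show False by fastforce
    qed
    then obtain c where c: "c \<in> L x" "c \<notin> f ` U" by blast
    have "inj_on (f(x := c)) (insert x U)" "\<forall>v\<in>insert x U. (f(x := c)) v \<in> L v"
      using f c insert.hyps by (auto simp: inj_on_def)
    thus ?case by blast
  qed
  thus ?thesis using assms(1) by blast
qed

lemma two_dynamic_coloring_inj_on:
  assumes "simple_graph G" "inj_on f (verts G)"
  shows "two_dynamic_coloring G f"
proof -
  have "proper_coloring G f"
    unfolding proper_coloring_def
  proof (intro ballI impI notI)
    fix u v assume uv: "u \<in> verts G" "v \<in> verts G" "{u, v} \<in> edges G" "f u = f v"
    hence "u = v" using assms(2) by (simp add: inj_on_eq_iff)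
    moreover have "card {u, v} = 2" using assms(1) uv(3) by (simp add: simple_graph_def)
    ultimately show False by simp
  qed
  moreover have "card (f ` nbrs G v) = degree G v" for v
    unfolding degree_def by (rule card_image, rule inj_on_subset[OF assms(2)]) (auto simp: nbrs_def)
  ultimately show ?thesis by (simp add: two_dynamic_coloring_def)
qed

lemma two_dynamic_choosable_card:
  assumes "simple_graph G" "card (verts G) \<le> k"
  shows "two_dynamic_choosable G k"
  unfolding two_dynamic_choosable_def
proof (intro allI impI)
  fix L assume "lists_of_size_ge G k L"
  hence "\<exists>f. inj_on f (verts G) \<and> (\<forall>v\<in>verts G. f v \<in> L v)"
    using assms by (intro injective_choice) (fastforce simp: lists_of_size_ge_def simple_graph_def)+
  thus "\<exists>f. two_dynamic_coloring G f \<and> (\<forall>v\<in>verts G. f v \<in> L v)"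
    using two_dynamic_coloring_inj_on[OF assms(1)] by blast
qed

lemma choosable_if_two_dynamic_choosable: "two_dynamic_choosable G k \<Longrightarrow> choosable G k"
  unfolding two_dynamic_choosable_def choosable_def two_dynamic_coloring_def by blast

lemma choosable_ch: "simple_graph G \<Longrightarrow> choosable G (ch G)"
  unfolding ch_def
  by (rule LeastI[of _ "card (verts G)"])
     (simp add: choosable_if_two_dynamic_choosable two_dynamic_choosable_card)

lemma two_dynamic_choosable_ch2: "simple_graph G \<Longrightarrow> 0 < ch2 G \<and> two_dynamic_choosable G (ch2 G)"
  unfolding ch2_def
  by (rule LeastI[of _ "Suc (card (verts G))"]) (simp add: two_dynamic_choosable_card)

end

theory Submission
  imports Defs "HOL-Real_Asymp.Real_Asymp"
begin

text \<open>
  A proper colouring \<open>f\<close> fails to be 2-dynamic only at a vertex whose whole neighbourhood has one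
  colour. Two different mechanisms exclude this, depending on \<open>p\<close>.

  If \<open>p \<ge> n powr (-3/5)\<close>, then almost surely every neighbourhood spans an edge: it has at least
  \<open>np/10\<close> vertices, so it is independent with probability at most
  \<open>exp (- p (np)\<^sup>2 / 400) \<le> exp (- n powr (1/5) / 400)\<close>. Hence every proper colouring is 2-dynamic.

  If \<open>p \<le> n powr (-3/5)\<close>, put \<open>D = 8np\<close>. Almost surely all degrees lie between \<open>D/80\<close> and \<open>D\<close>,
  and any two vertices have at most 14 common neighbours. The rest is deterministic. Given lists
  of size \<open>K = ch G + C\<close>, delete \<open>C\<close> random colours from every list and then colour \<open>G\<close> from what
  is left, which is possible by the definition of \<open>ch G\<close>, no matter which colours were deleted. If
  no colour survives in all the lists around a vertex \<open>v\<close>, then no proper colouring from the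
  shortened lists is constant around \<open>v\<close>. A given colour survives around \<open>v\<close> with probability at
  most \<open>(1 - 1/K) ^ (C d(v)) \<le> exp (- C D / (80 K))\<close>, and at most \<open>K\<close> colours have to be
  considered. If \<open>K = O(D / ln D)\<close> and \<open>C\<close> is a large constant, this adds up to \<open>O(D powr (-3))\<close>,
  while the events at \<open>v\<close> and \<open>w\<close> are dependent only if \<open>v\<close> and \<open>w\<close> have a common neighbour. The
  Lovasz local lemma (\<open>lovasz_local_lemma_Pi_pmf\<close>) then gives a choice of deletions that works at
  all vertices (\<open>two_dynamic_choosable_add\<close>).

  What remains is the bound \<open>ch G \<le> 8D / ln D + 1\<close> (\<open>choosable_if_few_common_neighbours\<close>), a weak
  form of the Johansson--Molloy theorem, for graphs with few triangles on each edge. It follows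
  by Rosenfeld's counting method, as in Martinsson's proof for triangle-free graphs: by induction
  on \<open>W\<close>, the number of proper list colourings of \<open>G[W \<union> {v}]\<close> is at least \<open>l\<close> times that of
  \<open>G[W]\<close> for a certain \<open>l > 0\<close> of order \<open>sqrt D / ln D\<close> (\<open>card_list_colorings_insert_ge\<close>).
  Equivalently, a uniformly random colouring of \<open>G[W]\<close> leaves on average at least \<open>l\<close> colours free
  at \<open>v\<close>. To see this, resample the colours around \<open>v\<close> while fixing all others.
\<close>

section \<open>Counting proper list colourings\<close>

text \<open>
  Colourings are functions in \<^const>\<open>PiE\<close>, that is, fixed to a default value off \<open>X\<close>, so that
  counting them makes sense.
\<close>

definition list_colorings :: "'v graph \<Rightarrow> 'v set \<Rightarrow> ('v \<Rightarrow> nat set) \<Rightarrow> ('v \<Rightarrow> nat) set" where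
  "list_colorings G X L =
     {f \<in> PiE X L. \<forall>u\<in>X. \<forall>v\<in>X. {u, v} \<in> edges G \<longrightarrow> f u \<noteq> f v}"

definition residual :: "'v graph \<Rightarrow> 'v set \<Rightarrow> ('v \<Rightarrow> nat) \<Rightarrow> ('v \<Rightarrow> nat set) \<Rightarrow> 'v \<Rightarrow> nat set" where
  "residual G X g L u = {c \<in> L u. \<forall>w\<in>X. {u, w} \<in> edges G \<longrightarrow> g w \<noteq> c}"

lemma finite_list_colorings:
  "finite X \<Longrightarrow> (\<And>u. u \<in> X \<Longrightarrow> finite (L u)) \<Longrightarrow> finite (list_colorings G X L)"
  unfolding list_colorings_def
  by (rule finite_subset[of _ "PiE X L"]) (auto intro: finite_PiE)

lemma residual_subset: "residual G X g L u \<subseteq> L u"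
  by (auto simp: residual_def)

text \<open>
  Colouring \<open>X\<close> first and then \<open>Y\<close> from the residual lists enumerates every colouring of
  \<open>X \<union> Y\<close> exactly once. All resampling arguments below are instances of this identity: \<open>g\<close> is the
  part that stays fixed and \<open>h\<close> is the part that is resampled.
\<close>

lemma sum_list_colorings_Un:
  fixes F :: "('v \<Rightarrow> nat) \<Rightarrow> 'b::comm_monoid_add"
  assumes fin: "finite X" "finite Y" "\<And>u. u \<in> X \<union> Y \<Longrightarrow> finite (L u)" and disj: "X \<inter> Y = {}"
  shows "(\<Sum>f\<in>list_colorings G (X \<union> Y) L. F f) =
         (\<Sum>g\<in>list_colorings G X L. \<Sum>h\<in>list_colorings G Y (residual G X g L).
            F (\<lambda>x. if x \<in> X then g x else h x))"
proof -
  let ?m = "\<lambda>(g, h) x. if x \<in> X then g x else h x :: nat"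
  let ?S = "SIGMA g:list_colorings G X L. list_colorings G Y (residual G X g L)"
  have "(\<Sum>g\<in>list_colorings G X L. \<Sum>h\<in>list_colorings G Y (residual G X g L). F (?m (g, h)))
      = (\<Sum>p\<in>?S. F (?m p))"
    by (subst sum.Sigma) (use fin in \<open>auto intro!: finite_list_colorings finite_subset[OF residual_subset] sum.cong
      simp only: case_prod_beta prod.collapse fst_conv snd_conv Un_iff\<close>)
  also have "\<dots> = (\<Sum>f\<in>list_colorings G (X \<union> Y) L. F f)"
  proof (rule sum.reindex_bij_witness[where i = "\<lambda>f. (restrict f X, restrict f Y)" and j = ?m])
    fix p assume "p \<in> ?S"
    then obtain g h where p: "p = (g, h)" and g: "g \<in> list_colorings G X L"
      and h: "h \<in> list_colorings G Y (residual G X g L)" by auto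
    have ext: "g \<in> extensional X" "h \<in> extensional Y"
      using g h by (auto simp: list_colorings_def PiE_def)
    have "restrict (?m p) X = g"
      using ext by (auto simp: p restrict_def extensional_def fun_eq_iff)
    moreover have "restrict (?m p) Y = h"
      using ext disj by (auto simp: p restrict_def extensional_def fun_eq_iff)
    ultimately show "(restrict (?m p) X, restrict (?m p) Y) = p" by (simp add: p)
    have gh: "h u \<noteq> g w" if "u \<in> Y" "w \<in> X" "{u, w} \<in> edges G" for u w
      using h that by (force simp: list_colorings_def residual_def PiE_def Pi_def)
    hence gh': "g w \<noteq> h u" if "u \<in> Y" "w \<in> X" "{w, u} \<in> edges G" for u w
      using that by (metis insert_commute)
    have "?m p \<in> PiE (X \<union> Y) L"
      using g h disj by (auto simp: p list_colorings_def residual_def PiE_def extensional_def Pi_def)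
    moreover have "?m p u \<noteq> ?m p v" if "u \<in> X \<union> Y" "v \<in> X \<union> Y" "{u, v} \<in> edges G" for u v
      using g h that gh gh' by (auto simp: p list_colorings_def)
    ultimately show "?m p \<in> list_colorings G (X \<union> Y) L" by (simp add: list_colorings_def)
  next
    fix f assume f: "f \<in> list_colorings G (X \<union> Y) L"
    have ext: "f \<in> extensional (X \<union> Y)" using f by (auto simp: list_colorings_def PiE_def)
    thus "?m (restrict f X, restrict f Y) = f"
      by (auto simp: extensional_def fun_eq_iff)
    have "restrict f X \<in> list_colorings G X L"
      using f by (auto simp: list_colorings_def)
    moreover have "restrict f Y \<in> list_colorings G Y (residual G X (restrict f X) L)"
      using f disj by (fastforce simp: list_colorings_def residual_def PiE_iff insert_commute)
    ultimately show "(restrict f X, restrict f Y) \<in> ?S" by simp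
  qed (auto)
  finally show ?thesis by simp
qed

lemma card_list_colorings_Un:
  assumes "finite X" "finite Y" "\<And>u. u \<in> X \<union> Y \<Longrightarrow> finite (L u)" "X \<inter> Y = {}"
  shows "card (list_colorings G (X \<union> Y) L) =
         (\<Sum>g\<in>list_colorings G X L. card (list_colorings G Y (residual G X g L)))"
  using sum_list_colorings_Un[of X Y L "\<lambda>_. 1::nat" G] assms by simp

lemma list_colorings_empty [simp]: "list_colorings G {} L = {\<lambda>_. undefined}"
  by (auto simp: list_colorings_def)

lemma card_list_colorings_insert:
  assumes "simple_graph G" "finite X" "\<And>w. w \<in> insert u X \<Longrightarrow> finite (L w)" "u \<notin> X"
  shows "card (list_colorings G (insert u X) L) =
         (\<Sum>g\<in>list_colorings G X L. card (residual G X g L u))"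
proof -
  have "{u, u} \<notin> edges G" using assms(1) by (auto simp: simple_graph_def)
  hence "list_colorings G {u} L' = PiE {u} L'" for L' :: "_ \<Rightarrow> nat set"
    by (auto simp: list_colorings_def)
  hence "card (list_colorings G {u} L') = card (L' u)" for L' :: "_ \<Rightarrow> nat set"
    by (simp add: card_PiE)
  thus ?thesis
    using card_list_colorings_Un[of X "{u}" L G] assms by simp
qed

lemma card_residual_ge:
  assumes "finite X" "finite (L u)" "card {w\<in>X. {u, w} \<in> edges G} \<le> t"
  shows "card (L u) \<le> card (residual G X g L u) + t"
proof -
  let ?B = "{w\<in>X. {u, w} \<in> edges G}"
  have "L u \<subseteq> residual G X g L u \<union> g ` ?B" by (auto simp: residual_def)
  hence "card (L u) \<le> card (residual G X g L u \<union> g ` ?B)"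
    using assms by (intro card_mono) (auto intro: finite_subset[OF residual_subset])
  also have "\<dots> \<le> card (residual G X g L u) + card (g ` ?B)" by (rule card_Un_le)
  also have "card (g ` ?B) \<le> t" using card_image_le[of ?B g] assms by simp
  finally show ?thesis by simp
qed

text \<open>
  Whatever the colours of the other vertices are, at least \<open>card (L u) - t\<close> colours are free
  at \<open>u\<close>. So in a uniformly random colouring \<open>u\<close> receives a given colour \<open>c\<close> with probability at
  most \<open>1 / (card (L u) - t)\<close>.
\<close>

lemma card_list_colorings_avoiding_at:
  assumes G: "simple_graph G" and fin: "finite Y" "\<And>u. u \<in> Y \<Longrightarrow> finite (L u)"
    and u: "u \<in> Y" "card {w\<in>Y. {u, w} \<in> edges G} \<le> t" "t < card (L u)"
  shows "(1 - 1 / (real (card (L u)) - t)) * card (list_colorings G Y L)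
         \<le> card {h \<in> list_colorings G Y L. h u \<noteq> c}"
proof -
  let ?C = "list_colorings G Y L" and ?C' = "list_colorings G (Y - {u}) L"
  have finC: "finite ?C" "finite ?C'" using fin by (auto intro: finite_list_colorings)
  have Y: "insert u (Y - {u}) = Y" using u by blast
  have "card {h \<in> ?C. h u = c} \<le> card ?C'"
  proof (rule card_inj_on_le[where f = "\<lambda>h. restrict h (Y - {u})"])
    show "inj_on (\<lambda>h. restrict h (Y - {u})) {h \<in> ?C. h u = c}"
    proof (rule inj_onI)
      fix h h' assume hh: "h \<in> {h \<in> ?C. h u = c}" "h' \<in> {h \<in> ?C. h u = c}"
        and eq: "restrict h (Y - {u}) = restrict h' (Y - {u})"
      show "h = h'"
      proof (rule extensionalityI[of _ Y])
        fix x assume "x \<in> Y"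
        thus "h x = h' x" using hh fun_cong[OF eq, of x] by (cases "x = u") auto
      qed (use hh in \<open>auto simp: list_colorings_def PiE_def\<close>)
    qed
  qed (use finC in \<open>auto simp: list_colorings_def PiE_iff split: if_splits\<close>)
  moreover have "(card (L u) - t) * card ?C' \<le> card ?C"
  proof -
    have "card {w \<in> Y - {u}. {u, w} \<in> edges G} \<le> t"
      using u(2) fin(1) by (rule_tac order_trans[OF card_mono]) auto
    hence "card (L u) - t \<le> card (residual G (Y - {u}) g L u)" for g
      using card_residual_ge[of "Y - {u}" L u G t g] fin u by simp
    hence "(\<Sum>g\<in>?C'. card (L u) - t) \<le> (\<Sum>g\<in>?C'. card (residual G (Y - {u}) g L u))"
      by (intro sum_mono)
    also have "\<dots> = card ?C"
    proof -
      have "card (list_colorings G (insert u (Y - {u})) L)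
          = (\<Sum>g\<in>?C'. card (residual G (Y - {u}) g L u))"
        using fin u(1) by (intro card_list_colorings_insert G) auto
      thus ?thesis by (simp only: Y)
    qed
    finally show ?thesis by (simp add: mult.commute)
  qed
  ultimately have "(card (L u) - t) * card {h \<in> ?C. h u = c} \<le> card ?C"
    by (meson le_trans mult_le_mono2)
  hence "real (card (L u) - t) * real (card {h \<in> ?C. h u = c}) \<le> real (card ?C)"
    unfolding of_nat_mult[symmetric] of_nat_le_iff .
  hence "real (card {h \<in> ?C. h u = c}) \<le> card ?C / (real (card (L u)) - t)"
    using u by (simp add: field_simps of_nat_diff)
  moreover have "real (card ?C) = card {h \<in> ?C. h u = c} + real (card {h \<in> ?C. h u \<noteq> c})"
    using finC by (subst of_nat_add[symmetric], subst card_Un_disjoint[symmetric])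
      (auto intro!: arg_cong[where f = card])
  moreover have "(1 - 1 / (real (card (L u)) - t)) * card ?C = card ?C - card ?C / (real (card (L u)) - t)"
    by (simp add: left_diff_distrib)
  ultimately show ?thesis by linarith
qed

text \<open>
  Although the colours of different vertices of \<open>Y\<close> are not independent, the lower bound for the
  probability that all of \<open>Y\<close> avoids \<open>c\<close> is the product one would get from independence. Indeed,
  conditioning on the event that some vertices avoid \<open>c\<close> amounts to deleting \<open>c\<close> from their
  lists, and the bound at the next vertex holds for arbitrary lists at the other vertices.
\<close>

lemma card_list_colorings_avoiding:
  assumes G: "simple_graph G" and fin: "finite Y" "\<And>u. u \<in> Y \<Longrightarrow> finite (L u)"
    and t: "\<And>u. u \<in> Y \<Longrightarrow> card {w\<in>Y. {u, w} \<in> edges G} \<le> t"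
           "\<And>u. u \<in> Y \<Longrightarrow> t < card (L u)"
  shows "(\<Prod>u\<in>Y. if c \<in> L u then 1 - 1 / (real (card (L u)) - t) else 1)
           * card (list_colorings G Y L)
         \<le> card {h \<in> list_colorings G Y L. c \<notin> h ` Y}"
proof -
  let ?a = "\<lambda>u. if c \<in> L u then 1 - 1 / (real (card (L u)) - t) else 1"
  let ?L = "\<lambda>Z w. if w \<in> Z then L w - {c} else L w"
  have a0: "0 \<le> ?a u" if "u \<in> Y" for u
    using t(2)[OF that] by (auto simp: field_simps)
  have "(\<Prod>u\<in>Z. ?a u) * card (list_colorings G Y L) \<le> card (list_colorings G Y (?L Z))"
    if "finite Z" "Z \<subseteq> Y" for Z using that
  proof (induction Z rule: finite_induct)
    case (insert u Z)
    have u: "u \<in> Y" using insert by blast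
    have IH: "(\<Prod>u\<in>Z. ?a u) * card (list_colorings G Y L) \<le> card (list_colorings G Y (?L Z))"
      using insert by blast
    have eq: "list_colorings G Y (?L (insert u Z)) = {h \<in> list_colorings G Y (?L Z). h u \<noteq> c}"
    proof (intro set_eqI iffI)
      fix h assume h: "h \<in> list_colorings G Y (?L (insert u Z))"
      have "h x \<in> ?L (insert u Z) x" if "x \<in> Y" for x
        using h that by (auto simp: list_colorings_def PiE_def Pi_def)
      thus "h \<in> {h \<in> list_colorings G Y (?L Z). h u \<noteq> c}"
        using h u by (force simp: list_colorings_def PiE_def Pi_def split: if_splits)
    next
      fix h assume "h \<in> {h \<in> list_colorings G Y (?L Z). h u \<noteq> c}"
      thus "h \<in> list_colorings G Y (?L (insert u Z))"
        by (force simp: list_colorings_def PiE_def Pi_def split: if_splits)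
    qed
    have "?a u * card (list_colorings G Y (?L Z)) \<le> card (list_colorings G Y (?L (insert u Z)))"
    proof (cases "c \<in> L u")
      case True
      thus ?thesis
        using card_list_colorings_avoiding_at[OF G fin(1), of "?L Z" u t c] insert.hyps t[OF u] fin(2) u
        unfolding eq by auto
    next
      case False
      hence "{h \<in> list_colorings G Y (?L Z). h u \<noteq> c} = list_colorings G Y (?L Z)"
        using u by (force simp: list_colorings_def PiE_def Pi_def split: if_splits)
      thus ?thesis using False unfolding eq by simp
    qed
    moreover have "?a u * ((\<Prod>u\<in>Z. ?a u) * card (list_colorings G Y L))
       \<le> ?a u * card (list_colorings G Y (?L Z))"
      using IH a0[OF u] by (rule mult_left_mono)
    ultimately show ?case using insert.hyps by (simp add: mult.assoc)
  qed simp
  from this[of Y] have "(\<Prod>u\<in>Y. ?a u) * card (list_colorings G Y L)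
      \<le> card (list_colorings G Y (?L Y))" using fin by simp
  also have "list_colorings G Y (?L Y) \<subseteq> {h \<in> list_colorings G Y L. c \<notin> h ` Y}"
    by (force simp: list_colorings_def PiE_def Pi_def)
  hence "card (list_colorings G Y (?L Y)) \<le> card {h \<in> list_colorings G Y L. c \<notin> h ` Y}"
    using finite_list_colorings[OF fin] by (intro card_mono) auto
  finally show ?thesis by simp
qed

text \<open>
  Jensen's inequality for \<open>exp\<close>, proved by means of the tangent at the mean.
\<close>

lemma sum_exp_minus_ge:
  fixes x :: "'b \<Rightarrow> real"
  assumes "finite S" "S \<noteq> {}" "sum x S \<le> X"
  shows "card S * exp (- X / card S) \<le> (\<Sum>c\<in>S. exp (- x c))"
proof -
  define m where "m = X / card S"
  have pos: "0 < real (card S)" using assms by (simp add: card_gt_0_iff)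
  have "exp (- m) * (1 + m - x c) \<le> exp (- x c)" for c
  proof -
    have "exp (- m) * (1 + (m - x c)) \<le> exp (- m) * exp (m - x c)"
      by (intro mult_left_mono exp_ge_add_one_self) simp
    thus ?thesis by (simp add: exp_add[symmetric] add_diff_eq)
  qed
  hence "(\<Sum>c\<in>S. exp (- m) * (1 + m - x c)) \<le> (\<Sum>c\<in>S. exp (- x c))" by (rule sum_mono)
  moreover have "(\<Sum>c\<in>S. exp (- m) * (1 + m - x c)) = exp (- m) * (card S * (1 + m) - sum x S)"
    by (simp only: sum_distrib_left[symmetric] sum_subtractf sum_constant)
  moreover have "exp (- m) * card S \<le> exp (- m) * (card S * (1 + m) - sum x S)"
  proof -
    have "card S * m = X" using pos by (simp add: m_def)
    thus ?thesis using assms(3) by (intro mult_left_mono) (auto simp: algebra_simps)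
  qed
  ultimately have "exp (- m) * card S \<le> (\<Sum>c\<in>S. exp (- x c))" by linarith
  thus ?thesis by (simp add: m_def mult.commute)
qed

text \<open>
  The condition \<open>x \<ge> 3 t + 4\<close> gives \<open>1 / (x - t) \<le> (3/2) / x\<close> and \<open>3 / x < 1\<close>.
\<close>

lemma one_minus_inverse_ge_exp:
  fixes x t :: real
  assumes "0 \<le> t" "3 * t + 4 \<le> x"
  shows "exp (- 3 / x) \<le> 1 - 1 / (x - t)"
proof -
  define y where "y = 3 / x"
  have x: "0 < x" "x - t > 0" using assms by auto
  have y: "0 < y" "y < 1" using assms x by (auto simp: y_def)
  have "exp y \<ge> 1 + y" by (rule exp_ge_add_one_self)
  hence "exp (- y) \<le> 1 / (1 + y)" using y by (simp add: exp_minus field_simps)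
  also have "1 / (1 + y) \<le> 1 - y / 2" using y by (simp add: field_simps)
  also have "1 / (x - t) \<le> y / 2" using x assms by (simp add: y_def field_simps)
  hence "1 - y / 2 \<le> 1 - 1 / (x - t)" by simp
  finally show ?thesis by (simp add: y_def)
qed

text \<open>
  For a list \<open>S\<close> at a vertex adjacent to all of \<open>Y\<close>, this bounds from below the average number of
  colours in \<open>S\<close> that a random colouring of \<open>Y\<close> does not use. The probability that \<open>c\<close> is not used
  is at least \<open>exp (- x c)\<close>, where \<open>x c\<close> is the sum of \<open>3 / card (L u)\<close> over the \<open>u\<close> whose list
  contains \<open>c\<close>. Each \<open>u\<close> contributes at most 3 to the sum of all \<open>x c\<close>, whatever the sizes of the
  lists are, and Jensen's inequality does the rest.
\<close>

lemma sum_free_colors_ge_without_small_lists: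
  assumes G: "simple_graph G" and fin: "finite Y" "\<And>u. u \<in> Y \<Longrightarrow> finite (L u)" "finite S"
    and t: "\<And>u. u \<in> Y \<Longrightarrow> card {w\<in>Y. {u, w} \<in> edges G} \<le> t"
           "\<And>u. u \<in> Y \<Longrightarrow> 3 * t + 4 \<le> card (L u)"
    and S: "S \<noteq> {}" and D: "card Y \<le> (D::real)"
  shows "card S * exp (- 3 * D / card S) * card (list_colorings G Y L)
         \<le> (\<Sum>h\<in>list_colorings G Y L. real (card (S - h ` Y)))"
proof -
  let ?C = "list_colorings G Y L"
  define x where "x c = (\<Sum>u\<in>Y. if c \<in> L u then 3 / card (L u) else 0 :: real)" for c
  have "sum x S = (\<Sum>u\<in>Y. \<Sum>c\<in>S. if c \<in> L u then 3 / card (L u) else 0 :: real)"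
    unfolding x_def by (rule sum.swap)
  also have "\<dots> \<le> (\<Sum>u\<in>Y. 3)"
  proof (rule sum_mono)
    fix u assume u: "u \<in> Y"
    have "(\<Sum>c\<in>S. if c \<in> L u then 3 / card (L u) else 0 :: real) = card (S \<inter> L u) * (3 / card (L u))"
      using fin by (simp add: sum.inter_restrict[symmetric])
    also have "\<dots> \<le> card (L u) * (3 / card (L u))"
      using fin u by (intro mult_right_mono) (auto intro!: card_mono)
    also have "\<dots> \<le> 3" by simp
    finally show "(\<Sum>c\<in>S. if c \<in> L u then 3 / card (L u) else 0 :: real) \<le> 3" .
  qed
  also have "\<dots> \<le> 3 * D" using D by simp
  finally have "card S * exp (- (3 * D) / card S) \<le> (\<Sum>c\<in>S. exp (- x c))"
    by (rule sum_exp_minus_ge[OF fin(3) S])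
  hence "card S * exp (- 3 * D / card S) * card ?C \<le> (\<Sum>c\<in>S. exp (- x c)) * card ?C"
    by (intro mult_right_mono) auto
  also have "\<dots> = (\<Sum>c\<in>S. exp (- x c) * card ?C)" by (rule sum_distrib_right)
  also have "\<dots> \<le> (\<Sum>c\<in>S. real (card {h \<in> ?C. c \<notin> h ` Y}))"
  proof (rule sum_mono)
    fix c
    have "exp (- x c) = (\<Prod>u\<in>Y. exp (- (if c \<in> L u then 3 / card (L u) else 0 :: real)))"
      by (simp add: x_def sum_negf[symmetric] exp_sum fin)
    also have "\<dots> \<le> (\<Prod>u\<in>Y. if c \<in> L u then 1 - 1 / (real (card (L u)) - t) else 1)"
    proof (rule prod_mono, safe)
      fix u assume u: "u \<in> Y"
      have "3 * real t + 4 \<le> real (card (L u))" using t(2)[OF u] by linarith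
      thus "exp (- (if c \<in> L u then 3 / card (L u) else 0 :: real))
            \<le> (if c \<in> L u then 1 - 1 / (real (card (L u)) - t) else 1)"
        using one_minus_inverse_ge_exp[of "real t" "real (card (L u))"] by simp
    qed simp
    finally have "exp (- x c) * card ?C \<le>
       (\<Prod>u\<in>Y. if c \<in> L u then 1 - 1 / (real (card (L u)) - t) else 1) * card ?C"
      by (intro mult_right_mono) auto
    also have "\<dots> \<le> card {h \<in> ?C. c \<notin> h ` Y}"
      using t(2) by (intro card_list_colorings_avoiding G fin t(1)) fastforce+
    finally show "exp (- x c) * card ?C \<le> card {h \<in> ?C. c \<notin> h ` Y}" .
  qed
  also have "\<dots> = (\<Sum>c\<in>S. \<Sum>h\<in>?C. if c \<notin> h ` Y then 1 else 0)"
    using finite_list_colorings[OF fin(1,2)] by (simp add: sum.inter_filter[symmetric])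
  also have "\<dots> = (\<Sum>h\<in>?C. \<Sum>c\<in>S. if c \<notin> h ` Y then 1 else 0)" by (rule sum.swap)
  also have "\<dots> = (\<Sum>h\<in>?C. real (card (S - h ` Y)))"
    using fin by (intro sum.cong) (simp_all add: sum.inter_filter[symmetric] set_diff_eq)
  finally show ?thesis .
qed

text \<open>
  If only a quarter as many vertices as there are colours in \<open>S\<close> have short lists, these can be
  coloured first: they use up at most a quarter of \<open>S\<close>, and they shorten each of the remaining
  lists by at most \<open>t\<close>. Lists longer than \<open>4 t + 4\<close> thus keep more than \<open>3 t + 4\<close> colours.
\<close>

lemma sum_free_colors_ge:
  assumes G: "simple_graph G" and fin: "finite N" "\<And>u. u \<in> N \<Longrightarrow> finite (L u)" "finite S"
    and t: "\<And>u. u \<in> N \<Longrightarrow> card {w\<in>N. {u, w} \<in> edges G} \<le> t"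
    and small: "4 * card {u\<in>N. card (L u) \<le> 4 * t + 4} \<le> card S"
    and S: "S \<noteq> {}" and D: "card N \<le> (D::real)"
  shows "3 / 4 * card S * exp (- 4 * D / card S) * card (list_colorings G N L)
         \<le> (\<Sum>h\<in>list_colorings G N L. real (card (S - h ` N)))"
proof -
  define M where "M = {u\<in>N. card (L u) \<le> 4 * t + 4}"
  define Y where "Y = N - M"
  let ?k = "real (card S)"
  have N: "M \<union> Y = N" "M \<inter> Y = {}" "finite M" "finite Y" "Y \<subseteq> N" "M \<subseteq> N"
    using fin by (auto simp: M_def Y_def)
  have kpos: "?k > 0" using S fin by (simp add: card_gt_0_iff)
  have D0: "D \<ge> 0" using D by linarith
  let ?m = "3 / 4 * ?k * exp (- 4 * D / ?k)"
  have inner: "?m * card (list_colorings G Y (residual G M g L))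
      \<le> (\<Sum>h\<in>list_colorings G Y (residual G M g L). real (card (S - (g ` M \<union> h ` Y))))" for g
  proof -
    let ?C = "list_colorings G Y (residual G M g L)"
    let ?S = "S - g ` M"
    have "card S - card (g ` M) \<le> card ?S" using N fin by (intro diff_card_le_card_Diff) auto
    moreover have "4 * card (g ` M) \<le> card S"
      using small card_image_le[OF N(3), of g] by (simp add: M_def)
    ultimately have S': "3 / 4 * ?k \<le> card ?S" by linarith
    hence "card ?S > 0" using kpos by linarith
    hence ne: "?S \<noteq> {}" by (intro notI) (simp only: card.empty less_irrefl)
    have tY: "card {w\<in>Y. {u, w} \<in> edges G} \<le> t" "card {w\<in>M. {u, w} \<in> edges G} \<le> t"
      if "u \<in> Y" for u
    proof -
      have "card {w\<in>A. {u, w} \<in> edges G} \<le> card {w\<in>N. {u, w} \<in> edges G}" if "A \<subseteq> N" for A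
        using that fin(1) by (intro card_mono) auto
      thus "card {w\<in>Y. {u, w} \<in> edges G} \<le> t" "card {w\<in>M. {u, w} \<in> edges G} \<le> t"
        using t[of u] N(5,6) \<open>u \<in> Y\<close> order_trans by blast+
    qed
    have "3 * t + 4 \<le> card (residual G M g L u)" if "u \<in> Y" for u
      using card_residual_ge[of M L u G t g] tY(2)[OF that] that N fin by (auto simp: Y_def M_def)
    moreover have "card Y \<le> D" using card_mono[OF fin(1) N(5)] D by linarith
    ultimately have *: "card ?S * exp (- 3 * D / card ?S) * card ?C
        \<le> (\<Sum>h\<in>?C. real (card (?S - h ` Y)))"
      using N fin tY(1) ne
      by (intro sum_free_colors_ge_without_small_lists G) (auto intro: finite_subset[OF residual_subset])
    have "3 * D / card ?S \<le> 3 * D / (3 / 4 * ?k)"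
      using S' kpos D0 by (intro divide_left_mono) auto
    hence "exp (- 4 * D / ?k) \<le> exp (- 3 * D / card ?S)" by simp
    hence "?m \<le> card ?S * exp (- 3 * D / card ?S)"
      using S' by (intro mult_mono) auto
    hence "?m * card ?C \<le> card ?S * exp (- 3 * D / card ?S) * card ?C"
      by (intro mult_right_mono) auto
    with * show ?thesis by (simp add: Diff_eq Int_assoc)
  qed
  have fin': "\<And>u. u \<in> M \<union> Y \<Longrightarrow> finite (L u)" using fin N by auto
  have "?m * card (list_colorings G N L)
      = (\<Sum>g\<in>list_colorings G M L. ?m * card (list_colorings G Y (residual G M g L)))"
    using card_list_colorings_Un[of M Y L G] N fin' by (simp add: sum_distrib_left)
  also have "\<dots> \<le> (\<Sum>g\<in>list_colorings G M L. \<Sum>h\<in>list_colorings G Y (residual G M g L).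
      real (card (S - (g ` M \<union> h ` Y))))"
    by (intro sum_mono inner)
  also have "\<dots> = (\<Sum>g\<in>list_colorings G M L. \<Sum>h\<in>list_colorings G Y (residual G M g L).
      real (card (S - (\<lambda>x. if x \<in> M then g x else h x) ` N)))"
  proof (intro sum.cong refl arg_cong[where f = "\<lambda>A. real (card (S - A))"])
    fix g h :: "_ \<Rightarrow> nat"
    show "g ` M \<union> h ` Y = (\<lambda>x. if x \<in> M then g x else h x) ` N"
      using N by (force simp: image_iff)
  qed
  also have "\<dots> = (\<Sum>f\<in>list_colorings G N L. real (card (S - f ` N)))"
    using sum_list_colorings_Un[of M Y L "\<lambda>f. real (card (S - f ` N))" G] N fin' by simp
  finally show ?thesis .
qed

text \<open>
  The induction step of Rosenfeld's method. Let \<open>N\<close> be the set of neighbours of \<open>v\<close> in \<open>W\<close>, fix the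
  colours of \<open>X = W - N\<close>, and average over the colourings of \<open>N\<close>. By \<open>sum_free_colors_ge\<close> there
  are \<open>2 l\<close> free colours at \<open>v\<close> on average, unless too many vertices of \<open>N\<close> have a short
  residual list. The induction hypothesis shows that the latter happens in at most half of the
  colourings of \<open>W\<close>: a colouring in which \<open>u\<close> has at most \<open>T\<close> free colours is one of at most \<open>T\<close>
  extensions of a colouring of \<open>W - {u}\<close>, whereas an average colouring of \<open>W - {u}\<close> has at
  least \<open>l\<close> extensions. So \<open>u\<close> has a short list with probability at most \<open>T / l\<close>, and Markov's
  inequality applies to the number of such \<open>u\<close>.
\<close>

lemma card_list_colorings_insert_ge:
  fixes D l :: real
  assumes G: "simple_graph G" and L: "\<And>u. u \<in> verts G \<Longrightarrow> finite (L u) \<and> card (L u) = k" and k: "0 < k"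
    and deg: "\<And>v. v \<in> verts G \<Longrightarrow> card (nbrs G v) \<le> D"
    and codeg: "\<And>u v. v \<in> verts G \<Longrightarrow> u \<in> nbrs G v \<Longrightarrow> card (nbrs G u \<inter> nbrs G v) \<le> t"
    and l: "0 < l" "l \<le> 3 / 8 * k * exp (- 4 * D / k)" "8 * D * (4 * t + 4) \<le> l * k"
    and W: "W \<subseteq> verts G" "v \<in> verts G" "v \<notin> W"
  shows "l * card (list_colorings G W L) \<le> card (list_colorings G (insert v W) L)"
  using W
proof (induction "card W" arbitrary: W v rule: less_induct)
  case less
  define N where "N = nbrs G v \<inter> W"
  define X where "X = W - N"
  define T where "T = 4 * t + 4"
  \<comment> \<open>The set \<open>small g\<close> depends only on the colours outside \<open>N\<close>, so it is unaffected when the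
      colours in \<open>N\<close> are resampled. The weight \<open>c g\<close> is the number of colourings of \<open>W\<close> extending \<open>g\<close>.\<close>
  define small where "small g = {u\<in>N. card (residual G X g L u) \<le> T}" for g
  define c where "c g = real (card (list_colorings G N (residual G X g L)))" for g
  let ?CX = "list_colorings G X L" and ?CW = "list_colorings G W L"
  have fV: "finite (verts G)" using G by (simp add: simple_graph_def)
  have fW: "finite W" "finite N" "finite X" and XN: "X \<union> N = W" "X \<inter> N = {}"
    using less.prems finite_subset[OF _ fV] by (auto simp: N_def X_def)
  have fL: "finite (L u)" if "u \<in> W" for u using L less.prems that by auto
  have fR: "finite (residual G X g L u)" if "u \<in> W" for u g
    using fL[OF that] by (rule finite_subset[OF residual_subset])
  have fCX: "finite ?CX" using fW fL XN by (intro finite_list_colorings) auto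
  have D0: "0 \<le> D" using deg[OF less.prems(2)] by linarith
  have cW: "real (card ?CW) = (\<Sum>g\<in>?CX. c g)"
    using card_list_colorings_Un[of X N L G] fW fL XN by (simp add: c_def)
  have c0: "0 \<le> c g" for g by (simp add: c_def)

  have small_at: "l * (\<Sum>g\<in>?CX. if u \<in> small g then c g else 0) \<le> T * card ?CW" if u: "u \<in> N" for u
  proof -
    have uW: "u \<in> W" using u by (simp add: N_def)
    have NN: "insert u (N - {u}) = N" using u by blast
    have "(\<Sum>g\<in>?CX. if u \<in> small g then c g else 0)
        \<le> (\<Sum>g\<in>?CX. T * real (card (list_colorings G (N - {u}) (residual G X g L))))"
    proof (rule sum_mono)
      fix g
      let ?R = "residual G X g L" and ?CN = "list_colorings G (N - {u}) (residual G X g L)"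
      show "(if u \<in> small g then c g else 0) \<le> T * real (card ?CN)"
      proof (cases "u \<in> small g")
        case True
        have "card (list_colorings G (insert u (N - {u})) ?R)
            = (\<Sum>h\<in>?CN. card (residual G (N - {u}) h ?R u))"
          using fW fR uW by (intro card_list_colorings_insert G) (auto simp: N_def)
        also have "\<dots> \<le> (\<Sum>h\<in>?CN. T)"
        proof (rule sum_mono)
          fix h
          have "card (residual G (N - {u}) h ?R u) \<le> card (?R u)"
            using fR[OF uW] by (intro card_mono residual_subset)
          thus "card (residual G (N - {u}) h ?R u) \<le> T" using True by (simp add: small_def)
        qed
        finally have "card (list_colorings G N ?R) \<le> T * card ?CN"
          unfolding NN by (simp add: mult.commute)
        hence "c g \<le> T * real (card ?CN)" unfolding c_def of_nat_mult[symmetric] of_nat_le_iff .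
        thus ?thesis using True by simp
      qed simp
    qed
    also have "\<dots> = T * real (card (list_colorings G (X \<union> (N - {u})) L))"
    proof -
      have "X \<inter> (N - {u}) = {}" using XN by blast
      moreover have "\<And>w. w \<in> X \<union> (N - {u}) \<Longrightarrow> finite (L w)" using fL XN by blast
      ultimately show ?thesis
        using card_list_colorings_Un[of X "N - {u}" L G] fW by (simp add: sum_distrib_left)
    qed
    also have "X \<union> (N - {u}) = W - {u}" using XN u by blast
    finally have "l * (\<Sum>g\<in>?CX. if u \<in> small g then c g else 0)
        \<le> T * (l * real (card (list_colorings G (W - {u}) L)))"
      using l(1) by (simp add: mult.left_commute)
    also have "l * real (card (list_colorings G (W - {u}) L)) \<le> card (list_colorings G (insert u (W - {u})) L)"
    proof (rule less.hyps)
      show "card (W - {u}) < card W" using uW fW by (intro psubset_card_mono) auto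
    qed (use uW less.prems in auto)
    also have "insert u (W - {u}) = W" using uW by blast
    finally show ?thesis by (simp add: mult_left_mono)
  qed

  define Bad where "Bad = {g\<in>?CX. k < 4 * card (small g)}"
  have "l * (k * sum c Bad) \<le> l * (\<Sum>g\<in>?CX. 4 * card (small g) * c g)"
  proof (rule mult_left_mono)
    have "k * sum c Bad = (\<Sum>g\<in>Bad. k * c g)" by (rule sum_distrib_left)
    also have "\<dots> \<le> (\<Sum>g\<in>Bad. 4 * card (small g) * c g)"
      using c0 by (intro sum_mono mult_right_mono) (auto simp: Bad_def)
    also have "\<dots> \<le> (\<Sum>g\<in>?CX. 4 * card (small g) * c g)"
      using c0 fCX by (intro sum_mono2) (auto simp: Bad_def)
    finally show "k * sum c Bad \<le> (\<Sum>g\<in>?CX. 4 * card (small g) * c g)" .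
  qed (use l in simp)
  also have "(\<Sum>g\<in>?CX. 4 * card (small g) * c g)
      = 4 * (\<Sum>u\<in>N. \<Sum>g\<in>?CX. if u \<in> small g then c g else 0)"
  proof -
    have "real (card (small g)) * c g = (\<Sum>u\<in>N. if u \<in> small g then c g else 0)" for g
    proof -
      have "{u\<in>N. u \<in> small g} = small g" by (auto simp: small_def)
      thus ?thesis using fW by (simp add: sum.inter_filter[symmetric])
    qed
    hence "(\<Sum>g\<in>?CX. 4 * card (small g) * c g)
        = 4 * (\<Sum>g\<in>?CX. \<Sum>u\<in>N. if u \<in> small g then c g else 0)"
      by (simp add: sum_distrib_left mult.assoc)
    thus ?thesis by (subst sum.swap)
  qed
  also have "l * \<dots> = 4 * (\<Sum>u\<in>N. l * (\<Sum>g\<in>?CX. if u \<in> small g then c g else 0))"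
    by (simp only: sum_distrib_left[symmetric] mult.left_commute)
  also have "\<dots> \<le> 4 * (\<Sum>u\<in>N. T * real (card ?CW))"
    using small_at by (intro mult_left_mono sum_mono) auto
  also have "\<dots> = 4 * (card N * (T * real (card ?CW)))" by simp
  also have "\<dots> \<le> 4 * (D * (T * real (card ?CW)))"
  proof -
    have "card N \<le> card (nbrs G v)"
      using fV by (intro card_mono) (auto simp: N_def nbrs_def)
    hence "card N \<le> D" using deg[OF less.prems(2)] by linarith
    thus ?thesis by (intro mult_left_mono mult_right_mono) auto
  qed
  also have "\<dots> = (8 * D * (4 * t + 4)) * card ?CW / 2" by (simp add: T_def)
  also have "\<dots> \<le> l * k * card ?CW / 2"
    using l(3) by (intro divide_right_mono mult_right_mono) auto
  finally have "(l * k) * sum c Bad \<le> (l * k) * (card ?CW / 2)" by (simp add: mult.assoc)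
  hence Bad: "sum c Bad \<le> card ?CW / 2" using l(1) k by simp
  have "sum c (?CX - Bad) = sum c ?CX - sum c Bad"
    using fCX by (intro sum_diff) (auto simp: Bad_def)
  hence good: "card ?CW / 2 \<le> sum c (?CX - Bad)" using Bad cW by linarith

  have "l * card ?CW \<le> 2 * l * sum c (?CX - Bad)"
    using mult_left_mono[OF good, of "2 * l"] l(1) by simp
  also have "\<dots> = (\<Sum>g\<in>?CX - Bad. 2 * l * c g)" by (rule sum_distrib_left)
  also have "\<dots> \<le> (\<Sum>g\<in>?CX - Bad. \<Sum>h\<in>list_colorings G N (residual G X g L). real (card (L v - h ` N)))"
  proof (rule sum_mono)
    fix g assume g: "g \<in> ?CX - Bad"
    have Lv: "finite (L v)" "card (L v) = k" using L less.prems by auto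
    have "2 * l * c g \<le> 3 / 4 * k * exp (- 4 * D / k) * c g"
      using l(2) c0 by (intro mult_right_mono) auto
    also have "\<dots> \<le> (\<Sum>h\<in>list_colorings G N (residual G X g L). real (card (L v - h ` N)))"
      unfolding c_def Lv(2)[symmetric]
    proof (rule sum_free_colors_ge[OF G fW(2) _ Lv(1)])
      show "finite (residual G X g L u)" if "u \<in> N" for u using fR that by (auto simp: N_def)
      show "card {w \<in> N. {u, w} \<in> edges G} \<le> t" if "u \<in> N" for u
      proof -
        have "card {w \<in> N. {u, w} \<in> edges G} \<le> card (nbrs G u \<inter> nbrs G v)"
          using fV less.prems by (intro card_mono) (auto simp: N_def nbrs_def insert_commute)
        also have "\<dots> \<le> t" using codeg[of v u] that less.prems by (auto simp: N_def)
        finally show ?thesis .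
      qed
      show "4 * card {u \<in> N. card (residual G X g L u) \<le> 4 * t + 4} \<le> card (L v)"
        using g by (auto simp: Bad_def small_def T_def Lv)
      show "L v \<noteq> {}" using Lv k by auto
      have "card N \<le> card (nbrs G v)"
        using fV by (intro card_mono) (auto simp: N_def nbrs_def)
      thus "card N \<le> D" using deg[OF less.prems(2)] by linarith
    qed
    finally show "2 * l * c g \<le> (\<Sum>h\<in>list_colorings G N (residual G X g L). real (card (L v - h ` N)))" .
  qed
  also have "\<dots> \<le> (\<Sum>g\<in>?CX. \<Sum>h\<in>list_colorings G N (residual G X g L). real (card (L v - h ` N)))"
    using fCX by (intro sum_mono2) (auto intro: sum_nonneg)
  also have "\<dots> = (\<Sum>g\<in>?CX. \<Sum>h\<in>list_colorings G N (residual G X g L).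
      real (card (residual G W (\<lambda>x. if x \<in> X then g x else h x) L v)))"
  proof (intro sum.cong refl arg_cong[where f = "\<lambda>A. real (card A)"])
    fix g h :: "_ \<Rightarrow> nat"
    have "{v, w} \<in> edges G \<longleftrightarrow> w \<in> N" if "w \<in> W" for w
      using that less.prems by (auto simp: N_def nbrs_def insert_commute)
    thus "L v - h ` N = residual G W (\<lambda>x. if x \<in> X then g x else h x) L v"
      using XN by (auto simp: residual_def)
  qed
  also have "\<dots> = (\<Sum>f\<in>?CW. real (card (residual G W f L v)))"
    using sum_list_colorings_Un[of X N L "\<lambda>f. real (card (residual G W f L v))" G] fW fL XN by simp
  also have "\<dots> = card (list_colorings G (insert v W) L)"
  proof -
    have "\<And>w. w \<in> insert v W \<Longrightarrow> finite (L w)" using L less.prems by blast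
    thus ?thesis using card_list_colorings_insert[of G W v L] G fW less.prems by simp
  qed
  finally show ?case .
qed

lemma list_colorings_nonempty:
  fixes D l :: real
  assumes G: "simple_graph G" and L: "\<And>u. u \<in> verts G \<Longrightarrow> finite (L u) \<and> card (L u) = k" and k: "0 < k"
    and deg: "\<And>v. v \<in> verts G \<Longrightarrow> card (nbrs G v) \<le> D"
    and codeg: "\<And>u v. v \<in> verts G \<Longrightarrow> u \<in> nbrs G v \<Longrightarrow> card (nbrs G u \<inter> nbrs G v) \<le> t"
    and l: "0 < l" "l \<le> 3 / 8 * k * exp (- 4 * D / k)" "8 * D * (4 * t + 4) \<le> l * k"
  shows "list_colorings G (verts G) L \<noteq> {}"
proof -
  have "0 < card (list_colorings G W L)" if "finite W" "W \<subseteq> verts G" for W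
    using that
  proof (induction W rule: finite_induct)
    case (insert v W)
    have "0 < l * card (list_colorings G W L)" using insert l(1) by simp
    also have "\<dots> \<le> card (list_colorings G (insert v W) L)"
      using insert by (intro card_list_colorings_insert_ge[OF assms]) auto
    finally show ?case by simp
  qed simp
  thus ?thesis using G by (fastforce simp: simple_graph_def)
qed

lemma lists_of_size_ge_trim:
  assumes "lists_of_size_ge G k L"
  obtains L' where "\<forall>v\<in>verts G. L' v \<subseteq> L v \<and> finite (L' v) \<and> card (L' v) = k"
proof -
  have "\<exists>A. A \<subseteq> L v \<and> finite A \<and> card A = k" if "v \<in> verts G" for v
  proof (cases "finite (L v)")
    case True
    hence "k \<le> card (L v)" using assms that by (auto simp: lists_of_size_ge_def)
    thus ?thesis by (rule obtain_subset_with_card_n) auto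
  next
    case False
    thus ?thesis using infinite_arbitrarily_large by blast
  qed
  hence "\<exists>L'. \<forall>v\<in>verts G. L' v \<subseteq> L v \<and> finite (L' v) \<and> card (L' v) = k" by (intro bchoice) blast
  thus ?thesis using that by blast
qed

text \<open>
  With \<open>k \<ge> 8 D / ln D\<close> colours the factor \<open>exp (- 4 D / k)\<close> is at least \<open>1 / sqrt D\<close>. So \<open>l\<close> is at
  least of order \<open>sqrt D / ln D\<close>, and \<open>l k\<close> exceeds every constant multiple of \<open>D\<close> for large \<open>D\<close>.
\<close>

lemma choosable_if_few_common_neighbours:
  fixes D :: real
  assumes G: "simple_graph G"
    and deg: "\<And>v. v \<in> verts G \<Longrightarrow> card (nbrs G v) \<le> D"
    and codeg: "\<And>u v. v \<in> verts G \<Longrightarrow> u \<in> nbrs G v \<Longrightarrow> card (nbrs G u \<inter> nbrs G v) \<le> t"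
    and D: "1 < D" "4 * (real t + 1) * (ln D)\<^sup>2 \<le> 3 * sqrt D"
    and k: "8 * D / ln D \<le> real k"
  shows "choosable G k"
  unfolding choosable_def
proof (intro allI impI)
  fix L assume "lists_of_size_ge G k L"
  then obtain L' where "\<forall>v\<in>verts G. L' v \<subseteq> L v \<and> finite (L' v) \<and> card (L' v) = k"
    by (rule lists_of_size_ge_trim)
  hence L': "\<And>v. v \<in> verts G \<Longrightarrow> L' v \<subseteq> L v \<and> finite (L' v) \<and> card (L' v) = k" by blast
  define l where "l = 3 / 8 * real k * exp (- 4 * D / k)"
  have lnD: "0 < ln D" using D by simp
  hence "0 < 8 * D / ln D" using D by simp
  hence kpos: "0 < real k" using k by linarith
  have "4 * D / k \<le> ln D / 2" using k kpos lnD by (simp add: field_simps)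
  hence "exp (- (ln D / 2)) \<le> exp (- 4 * D / k)" by simp
  moreover have "exp (- (ln D / 2)) = 1 / sqrt D"
  proof -
    have "exp (ln D / 2) = sqrt D"
      using D by (simp add: powr_half_sqrt[symmetric] powr_def)
    thus ?thesis by (simp add: exp_minus inverse_eq_divide)
  qed
  ultimately have e: "1 / sqrt D \<le> exp (- 4 * D / k)" by simp
  have "8 * D * (4 * t + 4) = 2 * (4 * (real t + 1) * (ln D)\<^sup>2) * (4 * D / (ln D)\<^sup>2)"
    using lnD by (simp add: field_simps)
  also have "\<dots> \<le> 2 * (3 * sqrt D) * (4 * D / (ln D)\<^sup>2)"
    using D by (intro mult_right_mono mult_left_mono) auto
  also have "\<dots> = 3 / 8 * (8 * D / ln D) * (1 / sqrt D) * (8 * D / ln D)"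
    using D by (simp add: field_simps power2_eq_square)
  also have "\<dots> \<le> 3 / 8 * real k * exp (- 4 * D / k) * real k"
    using k e lnD D by (intro mult_mono) auto
  finally have "8 * D * (4 * t + 4) \<le> l * k" by (simp add: l_def)
  hence "list_colorings G (verts G) L' \<noteq> {}"
    using kpos L' by (intro list_colorings_nonempty[OF G _ _ deg codeg, of L' k l]) (auto simp: l_def)
  then obtain f where "f \<in> list_colorings G (verts G) L'" by blast
  thus "\<exists>f. proper_coloring G f \<and> (\<forall>v\<in>verts G. f v \<in> L v)"
    using L' by (intro exI[of _ f]) (force simp: list_colorings_def proper_coloring_def PiE_iff)
qed

section \<open>The Lovasz local lemma for product measures\<close>

text \<open>
  One implication suffices, since the roles of \<open>f\<close> and \<open>g\<close> can be exchanged.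
\<close>

definition determined_by :: "('a \<Rightarrow> 'b) set \<Rightarrow> 'a set \<Rightarrow> bool" where
  "determined_by A S \<longleftrightarrow> (\<forall>f g. (\<forall>x\<in>S. f x = g x) \<longrightarrow> f \<in> A \<longrightarrow> g \<in> A)"

lemma determined_by_iff:
  assumes "determined_by A S" "\<And>x. x \<in> S \<Longrightarrow> f x = g x"
  shows "f \<in> A \<longleftrightarrow> g \<in> A"
  using assms(1)[unfolded determined_by_def, rule_format, of f g]
    assms(1)[unfolded determined_by_def, rule_format, of g f] assms(2) by auto

lemma prob_pair_pmf_Times:
  "measure_pmf.prob (pair_pmf M N) (A \<times> B) = measure_pmf.prob M A * measure_pmf.prob N B"
proof -
  have "measure_pmf.prob (pair_pmf M N) (A \<times> B)
      = measure_pmf.prob (pair_pmf M N) ((A \<inter> set_pmf M) \<times> (B \<inter> set_pmf N))"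
    by (rule measure_prob_cong_0) (auto simp: pmf_pair pmf_eq_0_set_pmf)
  also have "\<dots> = measure_pmf.prob M (A \<inter> set_pmf M) * measure_pmf.prob N (B \<inter> set_pmf N)"
    by (rule measure_pmf_prob_product) (auto intro: countable_subset[OF _ countable_set_pmf])
  finally show ?thesis by (simp add: measure_Int_set_pmf)
qed

lemma prob_Pi_pmf_Int:
  assumes fin: "finite I" and S: "S \<subseteq> I" "S \<inter> S' = {}"
    and det: "determined_by A S" "determined_by B S'"
  shows "measure_pmf.prob (Pi_pmf I d q) (A \<inter> B) =
         measure_pmf.prob (Pi_pmf I d q) A * measure_pmf.prob (Pi_pmf I d q) B"
proof -
  let ?m = "\<lambda>(f, g) x. if x \<in> S then f x else g x"
  let ?P = "pair_pmf (Pi_pmf S d q) (Pi_pmf (I - S) d q)"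
  have I: "Pi_pmf I d q = map_pmf ?m ?P"
  proof -
    have "finite S" using S(1) fin by (rule finite_subset)
    moreover have "S \<union> (I - S) = I" using S by blast
    ultimately show ?thesis
      using Pi_pmf_union[OF _ finite_Diff[OF fin, of S], of S d q] by (simp only: Diff_disjoint)
  qed
  have A: "?m p \<in> A \<longleftrightarrow> fst p \<in> A" for p
    by (rule determined_by_iff[OF det(1)]) (simp add: case_prod_beta)
  have B: "?m p \<in> B \<longleftrightarrow> snd p \<in> B" for p
    by (rule determined_by_iff[OF det(2)]) (use S in \<open>auto simp: case_prod_beta\<close>)
  have "?m -` (A \<inter> B) = A \<times> B" "?m -` A = A \<times> UNIV" "?m -` B = UNIV \<times> B"
    using A B by fastforce+
  thus ?thesis
    unfolding I measure_map_pmf by (simp only: prob_pair_pmf_Times) simp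
qed

text \<open>
  The symmetric local lemma, with its usual proof: by induction on \<open>W\<close>, the conditional
  probability of \<open>B v\<close> given that no event indexed by \<open>W\<close> occurs is at most \<open>2 p\<close>. Events are
  attached to sets \<open>S v\<close> of coordinates, which makes an event independent of any combination of
  events that use other coordinates.
\<close>

lemma lovasz_local_lemma_Pi_pmf:
  fixes I :: "'i set" and V :: "'v set" and B :: "'v \<Rightarrow> ('i \<Rightarrow> 'b) set" and p d :: real
  defines "good \<equiv> \<lambda>W. {\<omega>. \<forall>w\<in>W. \<omega> \<notin> B w}"
  assumes fin: "finite I" "finite V"
    and S: "\<And>v. v \<in> V \<Longrightarrow> S v \<subseteq> I" "\<And>v. v \<in> V \<Longrightarrow> determined_by (B v) (S v)"
    and p: "\<And>v. v \<in> V \<Longrightarrow> measure_pmf.prob (Pi_pmf I dflt q) (B v) \<le> p" "p < 1 / 2"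
    and dep: "\<And>v. v \<in> V \<Longrightarrow> card {w\<in>V. S v \<inter> S w \<noteq> {}} \<le> d" "4 * p * d \<le> 1"
  shows "0 < measure_pmf.prob (Pi_pmf I dflt q) (good V)"
proof -
  let ?P = "measure_pmf.prob (Pi_pmf I dflt q)"
  have step: "?P (B v \<inter> good W) \<le> 2 * p * ?P (good W)" if "W \<subseteq> V" "v \<in> V" for v W
    using that
  proof (induction "card W" arbitrary: W v rule: less_induct)
    case less
    have p0: "0 \<le> p" using p(1)[OF less.prems(2)] measure_nonneg order_trans by blast
    define W1 where "W1 = {w\<in>W. S v \<inter> S w \<noteq> {}}"
    define W2 where "W2 = W - W1"
    have finW: "finite W" "finite W1"
      using finite_subset[OF less.prems(1) fin(2)] by (auto simp: W1_def)
    have "determined_by (good W2) (\<Union>w\<in>W2. S w)"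
      unfolding determined_by_def
    proof (intro allI impI)
      fix f g assume fg: "\<forall>x\<in>\<Union>w\<in>W2. S w. f x = g x" "f \<in> good W2"
      have "g \<notin> B w" if w: "w \<in> W2" for w
      proof
        assume "g \<in> B w"
        moreover have "\<forall>x\<in>S w. g x = f x" using fg(1) w by fastforce
        moreover have "determined_by (B w) (S w)" using S(2) w less.prems by (auto simp: W2_def)
        ultimately have "f \<in> B w" unfolding determined_by_def by blast
        thus False using fg(2) w by (simp add: good_def)
      qed
      thus "g \<in> good W2" by (simp add: good_def)
    qed
    moreover have "S v \<inter> (\<Union>w\<in>W2. S w) = {}" by (auto simp: W1_def W2_def)
    ultimately have indep: "?P (B v \<inter> good W2) = ?P (B v) * ?P (good W2)"
      using less.prems S by (intro prob_Pi_pmf_Int fin(1)) auto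
    have "?P (B v \<inter> good W) \<le> ?P (B v \<inter> good W2)"
      by (intro measure_pmf.finite_measure_mono) (auto simp: good_def W2_def)
    also have "\<dots> \<le> p * ?P (good W2)"
      unfolding indep using p(1) less.prems by (intro mult_right_mono) auto
    \<comment> \<open>By induction, each of the at most \<open>d\<close> events in \<open>W1\<close> has conditional probability at most
        \<open>2 p\<close> given \<open>good W2\<close>, so together they cut off at most half of it.\<close>
    also have "?P (good W2) \<le> 2 * ?P (good W)"
    proof (cases "W1 = {}")
      case True
      thus ?thesis by (simp add: W2_def)
    next
      case False
      have lt: "card W2 < card W"
        using False finW by (intro psubset_card_mono) (auto simp: W1_def W2_def)
      have "?P (good W2) \<le> ?P (good W \<union> (\<Union>w\<in>W1. B w \<inter> good W2))"
        by (intro measure_pmf.finite_measure_mono) (auto simp: good_def W2_def)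
      also have "\<dots> \<le> ?P (good W) + ?P (\<Union>w\<in>W1. B w \<inter> good W2)"
        by (rule measure_Un_le) auto
      also have "?P (\<Union>w\<in>W1. B w \<inter> good W2) \<le> (\<Sum>w\<in>W1. ?P (B w \<inter> good W2))"
        using finW by (intro measure_pmf.finite_measure_subadditive_finite) auto
      also have "\<dots> \<le> (\<Sum>w\<in>W1. 2 * p * ?P (good W2))"
        using less.prems lt by (intro sum_mono less.hyps) (auto simp: W1_def W2_def)
      also have "\<dots> = card W1 * (2 * p * ?P (good W2))" by simp
      also have "\<dots> \<le> d * (2 * p * ?P (good W2))"
      proof -
        have "card W1 \<le> card {w\<in>V. S v \<inter> S w \<noteq> {}}"
          using less.prems fin by (intro card_mono) (auto simp: W1_def)
        hence "real (card W1) \<le> d" using dep(1)[OF less.prems(2)] by linarith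
        thus ?thesis using p0 by (intro mult_right_mono) auto
      qed
      also have "\<dots> = (4 * p * d) * (?P (good W2) / 2)" by simp
      also have "\<dots> \<le> 1 * (?P (good W2) / 2)"
        by (intro mult_right_mono dep(2)) auto
      finally show ?thesis by simp
    qed
    hence "p * ?P (good W2) \<le> p * (2 * ?P (good W))" using p0 by (rule mult_left_mono)
    finally show ?case by simp
  qed
  have "0 < ?P (good W)" if "finite W" "W \<subseteq> V" for W using that
  proof (induction W rule: finite_induct)
    case empty
    thus ?case by (simp add: good_def)
  next
    case (insert v W)
    hence pos: "0 < ?P (good W)" by simp
    have "good W = good (insert v W) \<union> (B v \<inter> good W)" by (auto simp: good_def)
    hence "?P (good W) \<le> ?P (good (insert v W)) + ?P (B v \<inter> good W)"
      by (metis measure_Un_le UNIV_I sets_measure_pmf)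
    moreover have "?P (B v \<inter> good W) \<le> 2 * p * ?P (good W)"
      using insert by (intro step) auto
    moreover have "2 * p * ?P (good W) < 1 * ?P (good W)"
      using p(2) pos by (intro mult_strict_right_mono) auto
    ultimately show ?case by linarith
  qed
  thus ?thesis using fin by simp
qed

section \<open>Deleting colours at random\<close>

text \<open>
  The coordinates of the product space are the pairs \<open>(u, i)\<close> with \<open>i < C\<close>. Coordinate \<open>(u, i)\<close> is
  a random element of \<open>L u\<close> to be deleted; repetitions do no harm. The bad event at \<open>v\<close> is that
  some colour survives in all lists around \<open>v\<close>. It depends on the coordinates at the neighbours of
  \<open>v\<close>, so it meets the coordinates of at most \<open>D\<^sup>2\<close> bad events.
\<close>

lemma two_dynamic_choosable_add:
  fixes D \<delta> :: real
  assumes G: "simple_graph G" and ch: "choosable G k" and C: "0 < C"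
    and deg: "\<And>v. v \<in> verts G \<Longrightarrow> \<delta> \<le> card (nbrs G v)" "\<And>v. v \<in> verts G \<Longrightarrow> card (nbrs G v) \<le> D"
    and D: "0 < \<delta>" "1 \<le> D" "4 * D\<^sup>2 * (real (k + C) * exp (- (real C * \<delta> / real (k + C)))) \<le> 1"
  shows "two_dynamic_choosable G (k + C)"
  unfolding two_dynamic_choosable_def
proof (intro allI impI)
  fix L0 assume "lists_of_size_ge G (k + C) L0"
  then obtain L where "\<forall>v\<in>verts G. L v \<subseteq> L0 v \<and> finite (L v) \<and> card (L v) = k + C"
    by (rule lists_of_size_ge_trim)
  hence L: "\<And>v. v \<in> verts G \<Longrightarrow> L v \<subseteq> L0 v \<and> finite (L v) \<and> card (L v) = k + C" by blast
  let ?V = "verts G" and ?K = "real (k + C)"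
  define I where "I = ?V \<times> {..<C}"
  define q where "q x = pmf_of_set (L (fst x))" for x :: "'a \<times> nat"
  define P where "P = Pi_pmf I 0 q"
  define A where "A v c = {\<omega>. \<forall>u\<in>nbrs G v. c \<in> L u \<and> (\<forall>i<C. \<omega> (u, i) \<noteq> c)}" for v c
  define B where "B v = (\<Union>c. A v c)" for v
  define S where "S v = nbrs G v \<times> {..<C}" for v
  define p where "p = ?K * exp (- (real C * \<delta> / ?K))"
  have fV: "finite ?V" using G by (simp add: simple_graph_def)
  have fI: "finite I" using fV by (simp add: I_def)
  have nb: "nbrs G v \<subseteq> ?V" "finite (nbrs G v)" for v using fV by (auto simp: nbrs_def)
  have ne: "nbrs G v \<noteq> {}" if "v \<in> ?V" for v
    using deg(1)[OF that] D(1) by auto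

  have pA: "measure_pmf.prob P (A v c) \<le> exp (- (real C * \<delta> / ?K))" if v: "v \<in> ?V" for v c
  proof (cases "\<forall>u\<in>nbrs G v. c \<in> L u")
    case False
    hence "A v c = {}" by (auto simp: A_def)
    thus ?thesis by simp
  next
    case True
    let ?B = "\<lambda>x. if fst x \<in> nbrs G v then - {c} else UNIV :: nat set"
    have "measure_pmf.prob P (A v c) \<le> measure_pmf.prob P (Pi I ?B)"
      by (intro measure_pmf.finite_measure_mono) (auto simp: A_def I_def)
    also have "\<dots> = (\<Prod>x\<in>I. measure_pmf.prob (q x) (?B x))"
      unfolding P_def by (rule measure_Pi_pmf_Pi[OF fI])
    also have "\<dots> = (\<Prod>x\<in>I. if x \<in> S v then 1 - 1 / ?K else 1)"
    proof (rule prod.cong[OF refl])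
      fix x assume x: "x \<in> I"
      have L': "finite (L (fst x))" "card (L (fst x)) = k + C" using L x by (auto simp: I_def)
      hence "L (fst x) \<noteq> {}" using C by auto
      moreover have "card (L (fst x) \<inter> - {c}) = k + C - 1" if "fst x \<in> nbrs G v"
        using True that L' by (simp add: Diff_eq[symmetric])
      ultimately show "measure_pmf.prob (q x) (?B x) = (if x \<in> S v then 1 - 1 / ?K else 1)"
        using L' C x by (auto simp: q_def measure_pmf_of_set S_def I_def of_nat_diff diff_divide_distrib)
    qed
    also have "\<dots> = (1 - 1 / ?K) ^ card (S v)"
    proof -
      have "{x\<in>I. x \<in> S v} = S v" using nb by (auto simp: S_def I_def)
      thus ?thesis using fI by (simp add: prod.inter_filter[symmetric])
    qed
    also have "\<dots> \<le> exp (- (1 / ?K)) ^ card (S v)"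
      using C exp_ge_add_one_self[of "- (1 / ?K)"] by (intro power_mono) (auto simp: field_simps)
    also have "\<dots> = exp (- (real C * card (nbrs G v) / ?K))"
      by (simp add: S_def exp_of_nat_mult[symmetric] card_cartesian_product field_simps)
    also have "\<dots> \<le> exp (- (real C * \<delta> / ?K))"
      using deg(1)[OF v] by (auto intro!: divide_right_mono mult_left_mono)
    finally show ?thesis .
  qed
  have pB: "measure_pmf.prob P (B v) \<le> p" if v: "v \<in> ?V" for v
  proof -
    obtain u where u: "u \<in> nbrs G v" using ne[OF v] by blast
    hence Lu: "finite (L u)" "card (L u) = k + C" using L nb by blast+
    have "B v \<subseteq> (\<Union>c\<in>L u. A v c)" using u by (auto simp: B_def A_def)
    hence "measure_pmf.prob P (B v) \<le> measure_pmf.prob P (\<Union>c\<in>L u. A v c)"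
      by (intro measure_pmf.finite_measure_mono) auto
    also have "\<dots> \<le> (\<Sum>c\<in>L u. measure_pmf.prob P (A v c))"
      using Lu by (intro measure_pmf.finite_measure_subadditive_finite) auto
    also have "\<dots> \<le> (\<Sum>c\<in>L u. exp (- (real C * \<delta> / ?K)))" by (intro sum_mono pA v)
    finally show ?thesis by (simp add: p_def Lu)
  qed

  have "0 < measure_pmf.prob P {\<omega>. \<forall>v\<in>?V. \<omega> \<notin> B v}"
    unfolding P_def
  proof (rule lovasz_local_lemma_Pi_pmf[where S = S and p = p and d = "D\<^sup>2"])
    show "S v \<subseteq> I" for v using nb by (auto simp: S_def I_def)
    show "determined_by (B v) (S v)" for v
      unfolding determined_by_def B_def A_def S_def by fastforce
    show "measure_pmf.prob (Pi_pmf I 0 q) (B v) \<le> p" if "v \<in> ?V" for v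
      using pB[OF that] by (simp add: P_def)
    show "4 * p * D\<^sup>2 \<le> 1" using D(3) by (simp add: p_def mult_ac)
    moreover have "1 \<le> D\<^sup>2" using D by simp
    moreover have "0 \<le> p" by (simp add: p_def)
    ultimately have "4 * p * 1 \<le> 1" using mult_left_mono[of 1 "D\<^sup>2" "4 * p"] by linarith
    thus "p < 1 / 2" by simp
    fix v assume v: "v \<in> ?V"
    have "{w \<in> ?V. S v \<inter> S w \<noteq> {}} \<subseteq> (\<Union>u\<in>nbrs G v. nbrs G u)"
      using C by (auto simp: S_def nbrs_def insert_commute)
    hence "card {w \<in> ?V. S v \<inter> S w \<noteq> {}} \<le> card (\<Union>u\<in>nbrs G v. nbrs G u)"
      using nb by (intro card_mono) auto
    also have "\<dots> \<le> (\<Sum>u\<in>nbrs G v. card (nbrs G u))" by (rule card_UN_le[OF nb(2)])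
    finally have "real (card {w \<in> ?V. S v \<inter> S w \<noteq> {}}) \<le> (\<Sum>u\<in>nbrs G v. real (card (nbrs G u)))"
      unfolding of_nat_sum[symmetric] of_nat_le_iff .
    also have "\<dots> \<le> (\<Sum>u\<in>nbrs G v. D)" using nb(1) deg(2) by (intro sum_mono) blast
    also have "\<dots> \<le> D * D" using deg(2)[OF v] D by (simp add: mult_right_mono)
    finally show "real (card {w \<in> ?V. S v \<inter> S w \<noteq> {}}) \<le> D\<^sup>2" by (simp add: power2_eq_square)
  qed (use fV fI in auto)
  hence "{\<omega>. \<forall>v\<in>?V. \<omega> \<notin> B v} \<noteq> {}" by (intro notI) (simp only: measure_empty less_irrefl)
  then obtain \<omega> where \<omega>: "\<And>v. v \<in> ?V \<Longrightarrow> \<omega> \<notin> B v" by blast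

  define L' where "L' v = L v - (\<lambda>i. \<omega> (v, i)) ` {..<C}" for v
  have "lists_of_size_ge G k L'"
    unfolding lists_of_size_ge_def
  proof (intro ballI disjI2)
    fix v assume v: "v \<in> ?V"
    have "card (L v) - card ((\<lambda>i. \<omega> (v, i)) ` {..<C}) \<le> card (L' v)"
      unfolding L'_def by (rule diff_card_le_card_Diff) simp
    moreover have "card ((\<lambda>i. \<omega> (v, i)) ` {..<C}) \<le> C"
      using card_image_le[of "{..<C}" "\<lambda>i. \<omega> (v, i)"] by simp
    ultimately show "k \<le> card (L' v)" using L[OF v] by linarith
  qed
  then obtain f where f: "proper_coloring G f" "\<And>v. v \<in> ?V \<Longrightarrow> f v \<in> L' v"
    using ch by (auto simp: choosable_def)
  have "2 \<le> card (f ` nbrs G v)" if v: "v \<in> ?V" for v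
  proof (rule ccontr)
    assume "\<not> 2 \<le> card (f ` nbrs G v)"
    moreover have "0 < card (f ` nbrs G v)" using ne[OF v] nb by (simp add: card_gt_0_iff)
    ultimately have "card (f ` nbrs G v) = 1" by linarith
    then obtain c where "f ` nbrs G v = {c}" by (auto simp: card_1_singleton_iff)
    hence "f u = c" if "u \<in> nbrs G v" for u using imageI[OF that, of f] by simp
    moreover have "f u \<in> L' u" if "u \<in> nbrs G v" for u using f(2) nb(1) that by blast
    ultimately have "\<forall>u\<in>nbrs G v. c \<in> L' u" by metis
    hence "\<omega> \<in> A v c" by (auto simp: A_def L'_def)
    thus False using \<omega>[OF v] by (auto simp: B_def)
  qed
  hence "two_dynamic_coloring G f" using f(1) by (force simp: two_dynamic_coloring_def)
  moreover have "\<forall>v\<in>?V. f v \<in> L0 v" using f(2) L by (auto simp: L'_def)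
  ultimately show "\<exists>f. two_dynamic_coloring G f \<and> (\<forall>v\<in>?V. f v \<in> L0 v)" by blast
qed

text \<open>
  The constant: \<open>K = ch G + 5120\<close> is at most \<open>16 D / ln D\<close>, so a colour survives around a vertex
  with probability at most \<open>exp (- 5120 (D / 80) / K) \<le> exp (- 4 ln D)\<close>. This beats the number \<open>D\<^sup>2\<close>
  of dependent events times the number \<open>K\<close> of colours.
\<close>

lemma ch2_le_ch_add:
  fixes D :: real
  assumes G: "simple_graph G"
    and deg: "\<And>v. v \<in> verts G \<Longrightarrow> D / 80 \<le> card (nbrs G v)" "\<And>v. v \<in> verts G \<Longrightarrow> card (nbrs G v) \<le> D"
    and codeg: "\<And>u v. v \<in> verts G \<Longrightarrow> u \<in> nbrs G v \<Longrightarrow> card (nbrs G u \<inter> nbrs G v) \<le> t"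
    and D: "64 \<le> D" "4 * (real t + 1) * (ln D)\<^sup>2 \<le> 3 * sqrt D" "5121 \<le> 8 * D / ln D"
  shows "ch2 G \<le> ch G + 5120"
proof -
  have "exp 1 \<le> (3::real)" by (rule exp_le)
  hence "ln D \<ge> 1" using D by (subst ln_ge_iff) auto
  define K where "K = real (ch G + 5120)"
  have "choosable G (nat \<lceil>8 * D / ln D\<rceil>)"
    using D by (intro choosable_if_few_common_neighbours[OF G deg(2) codeg]) auto
  hence "ch G \<le> nat \<lceil>8 * D / ln D\<rceil>" unfolding ch_def by (rule Least_le)
  hence "real (ch G) \<le> 8 * D / ln D + 1" using D(3) by linarith
  hence K: "0 < K" "K \<le> 16 * D / ln D" using D(3) by (auto simp: K_def)
  have "4 * ln D \<le> real 5120 * (D / 80) / K"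
    using K \<open>1 \<le> ln D\<close> by (simp add: field_simps)
  hence "exp (- (real 5120 * (D / 80) / K)) \<le> exp (- (4 * ln D))" by simp
  also have "exp (- (4 * ln D)) = 1 / D ^ 4"
    using D exp_of_nat_mult[of 4 "ln D"] by (simp add: exp_minus inverse_eq_divide)
  finally have "4 * D\<^sup>2 * (K * exp (- (real 5120 * (D / 80) / K))) \<le> 4 * D\<^sup>2 * (16 * D / ln D * (1 / D ^ 4))"
    using K D by (intro mult_left_mono mult_mono) auto
  also have "\<dots> \<le> 1"
  proof -
    have "64 \<le> D * ln D" using mult_mono[of 64 D 1 "ln D"] D \<open>1 \<le> ln D\<close> by simp
    thus ?thesis using D \<open>1 \<le> ln D\<close> by (simp add: field_simps power2_eq_square power4_eq_xxxx)
  qed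
  finally have "two_dynamic_choosable G (ch G + 5120)"
    using D deg by (intro two_dynamic_choosable_add[where \<delta> = "D / 80" and D = D] G choosable_ch)
      (auto simp: K_def)
  thus ?thesis unfolding ch2_def by (intro Least_le) simp
qed

text \<open>
  The ends of an edge inside a neighbourhood have different colours. The summand 1 is there only
  because \<^const>\<open>ch2\<close> is positive by definition, while \<^const>\<open>ch\<close> of the empty graph is 0.
\<close>

lemma ch2_le_ch_add_if_triangle_at_each_vertex:
  assumes G: "simple_graph G"
    and tri: "\<And>v. v \<in> verts G \<Longrightarrow> \<exists>u\<in>nbrs G v. \<exists>w\<in>nbrs G v. {u, w} \<in> edges G"
  shows "ch2 G \<le> ch G + 1"
proof -
  have "two_dynamic_coloring G f" if f: "proper_coloring G f" for f :: "'a \<Rightarrow> nat"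
  proof -
    have "2 \<le> card (f ` nbrs G v)" if v: "v \<in> verts G" for v
    proof -
      obtain u w where uw: "u \<in> nbrs G v" "w \<in> nbrs G v" "{u, w} \<in> edges G" using tri[OF v] by blast
      hence "f u \<noteq> f w" using f by (auto simp: proper_coloring_def nbrs_def)
      hence "2 = card {f u, f w}" by simp
      also have "\<dots> \<le> card (f ` nbrs G v)"
        using uw G by (intro card_mono) (auto simp: simple_graph_def nbrs_def)
      finally show ?thesis .
    qed
    thus ?thesis using f by (force simp: two_dynamic_coloring_def)
  qed
  moreover have "lists_of_size_ge G (ch G) L" if "lists_of_size_ge G (ch G + 1) L" for L
    using that by (fastforce simp: lists_of_size_ge_def)
  ultimately have "two_dynamic_choosable G (ch G + 1)"
    using choosable_ch[OF G] unfolding choosable_def two_dynamic_choosable_def by meson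
  thus ?thesis unfolding ch2_def by (intro Least_le) simp
qed

section \<open>Degrees and neighbourhoods in the random graph\<close>

abbreviation coins :: "nat \<Rightarrow> real \<Rightarrow> (nat set \<Rightarrow> bool) pmf" where
  "coins n p \<equiv> Pi_pmf (vertex_pairs n) False (\<lambda>_. bernoulli_pmf p)"

definition coin_graph :: "nat \<Rightarrow> (nat set \<Rightarrow> bool) \<Rightarrow> nat graph" where
  "coin_graph n b = \<lparr>verts = {..<n}, edges = {e \<in> vertex_pairs n. b e}\<rparr>"

lemma prob_random_graph:
  "measure_pmf.prob (random_graph n p) A = measure_pmf.prob (coins n p) {b. coin_graph n b \<in> A}"
  by (simp add: random_graph_def coin_graph_def vimage_def)

lemma simple_graph_coin_graph: "simple_graph (coin_graph n b)"
  by (auto simp: simple_graph_def coin_graph_def vertex_pairs_def)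

lemma finite_vertex_pairs: "finite (vertex_pairs n)"
  by (rule finite_subset[of _ "Pow {..<n}"]) (auto simp: vertex_pairs_def)

lemma nbrs_coin_graph:
  assumes "v < n"
  shows "nbrs (coin_graph n b) v = {u \<in> {..<n} - {v}. b {u, v}}"
  using assms by (auto simp: nbrs_def coin_graph_def vertex_pairs_def card_2_iff')

definition star_pairs :: "nat \<Rightarrow> nat \<Rightarrow> nat set set" where
  "star_pairs n v = (\<lambda>u. {u, v}) ` ({..<n} - {v})"

lemma star_pairs:
  assumes "v < n"
  shows "star_pairs n v \<subseteq> vertex_pairs n" "card (star_pairs n v) = n - 1"
    "card (nbrs (coin_graph n b) v) = card {e \<in> star_pairs n v. b e}"
proof -
  have inj: "inj_on (\<lambda>u. {u, v}) A" for A by (auto simp: inj_on_def doubleton_eq_iff)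
  show "star_pairs n v \<subseteq> vertex_pairs n" using assms by (auto simp: star_pairs_def vertex_pairs_def)
  show "card (star_pairs n v) = n - 1"
    unfolding star_pairs_def using assms by (subst card_image[OF inj]) simp
  have "{e \<in> star_pairs n v. b e} = (\<lambda>u. {u, v}) ` nbrs (coin_graph n b) v"
    using assms by (auto simp: nbrs_coin_graph star_pairs_def)
  thus "card (nbrs (coin_graph n b) v) = card {e \<in> star_pairs n v. b e}"
    by (simp add: card_image[OF inj])
qed

text \<open>
  Markov's inequality for \<open>x\<close> to the power of the number of heads. For \<open>x > 1\<close> it bounds the upper
  tail and for \<open>x < 1\<close> the lower tail.
\<close>

lemma prob_bernoulli_count_tail:
  fixes x c p :: real
  assumes fin: "finite I" "J \<subseteq> I" and p: "0 \<le> p" "p \<le> 1" and x: "0 < x" and c: "0 < c"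
  shows "measure_pmf.prob (Pi_pmf I False (\<lambda>_. bernoulli_pmf p)) {b. c \<le> x ^ card {j\<in>J. b j}}
         \<le> exp (card J * p * (x - 1)) / c"
proof -
  let ?M = "Pi_pmf I False (\<lambda>_. bernoulli_pmf p)"
  let ?f = "\<lambda>j y. if j \<in> J \<and> y then x else 1 :: real"
  have finJ: "finite J" using fin finite_subset by blast
  have eq: "x ^ card {j\<in>J. b j} = (\<Prod>j\<in>I. ?f j (b j))" for b
  proof -
    have "{j\<in>I. j \<in> J \<and> b j} = {j\<in>J. b j}" using fin by auto
    thus ?thesis using fin by (simp add: prod.inter_filter[symmetric])
  qed
  have int: "integrable (bernoulli_pmf p) (?f j)" for j
    by (rule integrable_measure_pmf_finite) (simp add: finite_subset[OF subset_UNIV])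
  have "measure_pmf.expectation ?M (\<lambda>b. \<Prod>j\<in>I. ?f j (b j))
      = (\<Prod>j\<in>I. measure_pmf.expectation (bernoulli_pmf p) (?f j))"
    using x by (intro expectation_prod_Pi_pmf fin int) auto
  also have "\<dots> = (\<Prod>j\<in>I. if j \<in> J then 1 + p * (x - 1) else 1)"
    using p by (intro prod.cong) (auto simp: algebra_simps)
  also have "\<dots> = (1 + p * (x - 1)) ^ card J"
  proof -
    have "{j\<in>I. j \<in> J} = J" using fin by auto
    thus ?thesis using fin by (simp add: prod.inter_filter[symmetric])
  qed
  also have "\<dots> \<le> exp (p * (x - 1)) ^ card J"
  proof (rule power_mono)
    have "1 + p * (x - 1) = (1 - p) + p * x" by (simp add: algebra_simps)
    also have "0 \<le> \<dots>" using p x by (intro add_nonneg_nonneg) auto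
    finally show "0 \<le> 1 + p * (x - 1)" .
  qed (rule exp_ge_add_one_self)
  also have "\<dots> = exp (card J * p * (x - 1))" by (simp add: exp_of_nat_mult[symmetric] mult.assoc)
  finally have E: "measure_pmf.expectation ?M (\<lambda>b. \<Prod>j\<in>I. ?f j (b j)) \<le> exp (card J * p * (x - 1))" .
  have "measure_pmf.prob ?M {b \<in> space ?M. c \<le> (\<Prod>j\<in>I. ?f j (b j))}
      \<le> measure_pmf.expectation ?M (\<lambda>b. \<Prod>j\<in>I. ?f j (b j)) / c"
    using x c by (intro integral_Markov_inequality_measure[where A = "{}"] integrable_prod_Pi_pmf fin int)
      (auto intro!: prod_nonneg AE_I2)
  also have "\<dots> \<le> exp (card J * p * (x - 1)) / c" using E c by (intro divide_right_mono) auto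
  finally show ?thesis by (simp add: eq)
qed

lemma prob_all_heads:
  assumes "finite I" "F \<subseteq> I" "0 \<le> p" "p \<le> 1"
  shows "measure_pmf.prob (Pi_pmf I False (\<lambda>_. bernoulli_pmf p)) {b. \<forall>e\<in>F. b e = y}
         = (if y then p else 1 - p) ^ card F"
proof -
  let ?B = "\<lambda>e. if e \<in> F then {y} else UNIV"
  have "{b. \<forall>e\<in>F. b e = y} = Pi I ?B" using assms(2) by (auto simp: Pi_def)
  hence "measure_pmf.prob (Pi_pmf I False (\<lambda>_. bernoulli_pmf p)) {b. \<forall>e\<in>F. b e = y}
      = (\<Prod>e\<in>I. measure_pmf.prob (bernoulli_pmf p) (?B e))"
    using assms(1) by (simp only: measure_Pi_pmf_Pi)
  also have "\<dots> = (\<Prod>e\<in>I. if e \<in> F then (if y then p else 1 - p) else 1)"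
    using assms by (intro prod.cong) (auto simp: measure_pmf_single)
  also have "\<dots> = (if y then p else 1 - p) ^ card F"
  proof -
    have "{e\<in>I. e \<in> F} = F" using assms by auto
    thus ?thesis using assms(1) by (simp add: prod.inter_filter[symmetric])
  qed
  finally show ?thesis .
qed

lemma prob_UN_le:
  fixes c :: real
  assumes "finite T" "\<And>t. t \<in> T \<Longrightarrow> measure_pmf.prob M (A t) \<le> c"
  shows "measure_pmf.prob M (\<Union>t\<in>T. A t) \<le> card T * c"
proof -
  have "measure_pmf.prob M (\<Union>t\<in>T. A t) \<le> (\<Sum>t\<in>T. measure_pmf.prob M (A t))"
    using assms(1) by (intro measure_pmf.finite_measure_subadditive_finite) auto
  also have "\<dots> \<le> card T * c" using sum_bounded_above[of T "\<lambda>t. measure_pmf.prob M (A t)" c] assms(2) by simp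
  finally show ?thesis .
qed

text \<open>
  The exponential moment with \<open>x = 8\<close>: \<open>7 np - 8 np ln 8 \<le> - 9 np\<close>, which is much less than
  \<open>- 2 ln n\<close>.
\<close>

lemma prob_large_degree:
  fixes p :: real
  assumes n: "2 \<le> n" and p: "6 * ln (real n) / n < p" "p \<le> 1"
  shows "measure_pmf.prob (coins n p) {b. \<exists>v<n. 8 * (n * p) < card (nbrs (coin_graph n b) v)} \<le> 1 / n"
proof -
  let ?d = "n * p"
  have ln0: "0 < ln (real n)" using n by simp
  have d: "6 * ln (real n) < ?d" using p n by (simp add: field_simps)
  have "0 < 6 * ln (real n) / n" using ln0 n by simp
  hence p0: "0 \<le> p" using p by linarith
  have ln8: "2 \<le> ln (8::real)"
  proof -
    have "exp 1 < (2.75 :: real)" using e_less_272 by simp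
    hence "exp 1 ^ 2 < (2.75 :: real) ^ 2" by (intro power_strict_mono) auto
    hence "exp 2 \<le> (8::real)" using exp_of_nat_mult[of 2 "1::real"] by (simp add: power2_eq_square)
    thus ?thesis by (simp add: ln_ge_iff)
  qed
  have "measure_pmf.prob (coins n p) {b. 8 * ?d < card (nbrs (coin_graph n b) v)} \<le> 1 / real n ^ 2"
    if v: "v < n" for v
  proof -
    have "measure_pmf.prob (coins n p) {b. 8 * ?d < card (nbrs (coin_graph n b) v)}
        \<le> measure_pmf.prob (coins n p) {b. 8 powr (8 * ?d) \<le> 8 ^ card {e \<in> star_pairs n v. b e}}"
      by (intro measure_pmf.finite_measure_mono)
        (auto simp: star_pairs(3)[OF v] powr_realpow[symmetric])
    also have "\<dots> \<le> exp (card (star_pairs n v) * p * (8 - 1)) / 8 powr (8 * ?d)"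
      using p0 p by (intro prob_bernoulli_count_tail finite_vertex_pairs star_pairs(1)[OF v]) auto
    also have "\<dots> = exp (card (star_pairs n v) * p * 7 - 8 * ?d * ln 8)"
      by (simp add: powr_def exp_diff)
    also have "\<dots> \<le> exp (- (2 * ln (real n)))"
    proof -
      have "card (star_pairs n v) * p * 7 \<le> ?d * 7"
        using p0 n by (simp add: star_pairs(2)[OF v] mult_right_mono)
      moreover have "8 * ?d * 2 \<le> 8 * ?d * ln 8" using ln8 p0 by (intro mult_left_mono) auto
      ultimately have "card (star_pairs n v) * p * 7 - 8 * ?d * ln 8 \<le> - (2 * ln (real n))"
        using d ln0 by linarith
      thus ?thesis by simp
    qed
    also have "\<dots> = 1 / real n ^ 2"
      using n exp_of_nat_mult[of 2 "ln (real n)"] by (simp add: exp_minus inverse_eq_divide)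
    finally show ?thesis .
  qed
  note single = this
  have "measure_pmf.prob (coins n p) (\<Union>v\<in>{..<n}. {b. 8 * ?d < card (nbrs (coin_graph n b) v)})
      \<le> card {..<n} * (1 / real n ^ 2)"
    by (rule prob_UN_le) (use single in auto)
  also have "\<dots> = 1 / n" by (simp add: power2_eq_square)
  also have "(\<Union>v\<in>{..<n}. {b. 8 * ?d < card (nbrs (coin_graph n b) v)})
      = {b. \<exists>v<n. 8 * ?d < card (nbrs (coin_graph n b) v)}" by auto
  finally show ?thesis .
qed

text \<open>
  The exponential moment with \<open>x = 1/2\<close>. The exponent is at most \<open>- (9/20) np + np / 10\<close>, which
  is \<open>- (7/20) np < - 2.1 ln n\<close> because \<open>np > 6 ln n\<close>. This leaves room for the union bound
  over the \<open>n\<close> vertices.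
\<close>

lemma prob_small_degree:
  fixes p :: real
  assumes n: "10 \<le> n" and p: "6 * ln (real n) / n < p" "p \<le> 1"
  shows "measure_pmf.prob (coins n p) {b. \<exists>v<n. card (nbrs (coin_graph n b) v) < n * p / 10} \<le> 1 / n"
proof -
  let ?d = "n * p"
  have ln0: "0 < ln (real n)" using n by simp
  have d: "6 * ln (real n) < ?d" using p n by (simp add: field_simps)
  have "0 < 6 * ln (real n) / n" using ln0 n by simp
  hence p0: "0 \<le> p" using p by linarith
  have "measure_pmf.prob (coins n p) {b. card (nbrs (coin_graph n b) v) < ?d / 10} \<le> 1 / real n ^ 2"
    if v: "v < n" for v
  proof -
    have "measure_pmf.prob (coins n p) {b. card (nbrs (coin_graph n b) v) < ?d / 10}
        \<le> measure_pmf.prob (coins n p) {b. (1 / 2) powr (?d / 10) \<le> (1 / 2) ^ card {e \<in> star_pairs n v. b e}}"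
      by (intro measure_pmf.finite_measure_mono)
        (auto simp: star_pairs(3)[OF v] powr_realpow[symmetric] intro!: powr_mono')
    also have "\<dots> \<le> exp (card (star_pairs n v) * p * (1 / 2 - 1)) / (1 / 2) powr (?d / 10)"
      using p0 p by (intro prob_bernoulli_count_tail finite_vertex_pairs star_pairs(1)[OF v]) auto
    also have "\<dots> = exp (- (card (star_pairs n v) * p / 2) + ?d / 10 * ln 2)"
      by (simp add: powr_def ln_div exp_diff[symmetric])
    also have "\<dots> \<le> exp (- (2 * ln (real n)))"
    proof -
      have "9 / 10 * n \<le> real (card (star_pairs n v))"
        using n by (simp add: star_pairs(2)[OF v] of_nat_diff)
      hence "9 / 10 * n * p \<le> card (star_pairs n v) * p" using p0 by (rule mult_right_mono)
      moreover have "?d / 10 * ln 2 \<le> ?d / 10 * 1"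
        using p0 ln_2_less_1 by (intro mult_left_mono) auto
      ultimately show ?thesis using d ln0 by simp
    qed
    also have "\<dots> = 1 / real n ^ 2"
      using n exp_of_nat_mult[of 2 "ln (real n)"] by (simp add: exp_minus inverse_eq_divide)
    finally show ?thesis .
  qed
  note single = this
  have "measure_pmf.prob (coins n p) (\<Union>v\<in>{..<n}. {b. card (nbrs (coin_graph n b) v) < ?d / 10})
      \<le> card {..<n} * (1 / real n ^ 2)"
    by (rule prob_UN_le) (use single in auto)
  also have "\<dots> = 1 / n" by (simp add: power2_eq_square)
  also have "(\<Union>v\<in>{..<n}. {b. card (nbrs (coin_graph n b) v) < ?d / 10})
      = {b. \<exists>v<n. card (nbrs (coin_graph n b) v) < ?d / 10}" by auto
  finally show ?thesis .
qed

text \<open>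
  A union bound over two vertices and 15 common neighbours: at most \<open>n ^ 17\<close> configurations,
  each requiring 30 edges. The threshold \<open>n powr (-3/5)\<close> makes the product at most \<open>n ^ 17 / n ^ 18\<close>.
\<close>

lemma prob_large_codegree:
  fixes p :: real
  assumes n: "1 \<le> n" and p: "0 \<le> p" "p \<le> 1" "p \<le> real n powr (- 3 / 5)"
  shows "measure_pmf.prob (coins n p)
           {b. \<exists>u<n. \<exists>v<n. u \<noteq> v \<and> 15 \<le> card (nbrs (coin_graph n b) u \<inter> nbrs (coin_graph n b) v)} \<le> 1 / n"
proof -
  define T where "T = {(u, v, W). u < n \<and> v < n \<and> u \<noteq> v \<and> W \<subseteq> {..<n} - {u, v} \<and> card W = 15}"
  define F where "F = (\<lambda>(u, v, W). (\<lambda>w. {w, u}) ` W \<union> (\<lambda>w. {w, v}) ` W :: nat set set)"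
  have T_sub: "T \<subseteq> {..<n} \<times> {..<n} \<times> {W. W \<subseteq> {..<n} \<and> card W = 15}" by (auto simp: T_def)
  have fin: "finite {W. W \<subseteq> {..<n} \<and> card W = 15}" by (rule finite_subset[of _ "Pow {..<n}"]) auto
  hence finT: "finite T" by (intro finite_subset[OF T_sub]) auto
  have "card T \<le> card ({..<n} \<times> {..<n} \<times> {W. W \<subseteq> {..<n} \<and> card W = 15})"
    using fin by (intro card_mono T_sub) auto
  also have "\<dots> = n * (n * (n choose 15))" by (simp add: card_cartesian_product n_subsets)
  also have "\<dots> \<le> n * (n * n ^ 15)"
  proof -
    have "n choose 15 \<le> n ^ 15" by (cases "15 \<le> n") (auto intro: binomial_le_pow simp: binomial_eq_0)
    thus ?thesis by simp
  qed
  also have "\<dots> = n ^ 17" by (simp add: power_numeral_reduce)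
  finally have cT: "card T \<le> n ^ 17" .
  have single: "measure_pmf.prob (coins n p) {b. \<forall>e\<in>F t. b e = True} \<le> p ^ 30" if t: "t \<in> T" for t
  proof -
    obtain u v W where t': "t = (u, v, W)" by (cases t)
    have *: "u < n" "v < n" "u \<noteq> v" "W \<subseteq> {..<n} - {u, v}" "card W = 15"
      using t by (auto simp: T_def t')
    have "F t \<subseteq> vertex_pairs n" using * by (auto simp: F_def t' vertex_pairs_def card_insert_if)
    moreover have "card (F t) = 30"
    proof -
      have inj: "inj_on (\<lambda>w. {w, x}) W" for x by (auto simp: inj_on_def doubleton_eq_iff)
      have "(\<lambda>w. {w, u}) ` W \<inter> (\<lambda>w. {w, v}) ` W = {}" using * by (auto simp: doubleton_eq_iff)
      moreover have "finite W" using *(5) by (intro card_ge_0_finite) simp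
      ultimately show ?thesis
        using * by (simp add: F_def t' card_Un_disjoint card_image[OF inj])
    qed
    ultimately show ?thesis
      using prob_all_heads[OF finite_vertex_pairs _ p(1,2), of "F t" n True] by simp
  qed
  have "{b. \<exists>u<n. \<exists>v<n. u \<noteq> v \<and> 15 \<le> card (nbrs (coin_graph n b) u \<inter> nbrs (coin_graph n b) v)}
      \<subseteq> (\<Union>t\<in>T. {b. \<forall>e\<in>F t. b e = True})"
  proof safe
    fix b u v assume uv: "u < n" "v < n" "u \<noteq> v"
      and "15 \<le> card (nbrs (coin_graph n b) u \<inter> nbrs (coin_graph n b) v)"
    from this(4) obtain W where W: "W \<subseteq> nbrs (coin_graph n b) u \<inter> nbrs (coin_graph n b) v" "card W = 15"
      by (rule obtain_subset_with_card_n)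
    hence "(u, v, W) \<in> T" using uv by (auto simp: T_def nbrs_coin_graph)
    moreover have "\<forall>e\<in>F (u, v, W). b e = True" using uv W by (auto simp: F_def nbrs_coin_graph)
    ultimately show "b \<in> (\<Union>t\<in>T. {b. \<forall>e\<in>F t. b e = True})" by blast
  qed
  hence "measure_pmf.prob (coins n p)
        {b. \<exists>u<n. \<exists>v<n. u \<noteq> v \<and> 15 \<le> card (nbrs (coin_graph n b) u \<inter> nbrs (coin_graph n b) v)}
      \<le> measure_pmf.prob (coins n p) (\<Union>t\<in>T. {b. \<forall>e\<in>F t. b e = True})"
    by (intro measure_pmf.finite_measure_mono) auto
  also have "\<dots> \<le> card T * p ^ 30" by (rule prob_UN_le[OF finT single])
  also have "\<dots> \<le> real (n ^ 17) * (real n powr (- 3 / 5)) ^ 30"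
    using cT p unfolding of_nat_le_iff[symmetric, where 'a = real] by (intro mult_mono power_mono) auto
  also have "(real n powr (- 3 / 5)) ^ 30 = real n powr (- 18)" using n by (simp add: powr_power)
  also have "\<dots> = 1 / real n ^ 18" using n by (simp add: powr_minus_divide)
  also have "real (n ^ 17) * (1 / real n ^ 18) = 1 / n" using n by (simp add: power_numeral_reduce)
  finally show ?thesis .
qed

text \<open>
  Which set \<open>S\<close> is the neighbourhood of \<open>v\<close> is decided by the pairs that contain \<open>v\<close>, and whether \<open>S\<close>
  is independent is decided by the pairs inside \<open>S\<close>. These are disjoint sets of coins.
\<close>

lemma prob_independent_neighbourhood:
  fixes p s :: real
  assumes v: "v < n" and p: "0 \<le> p" "p \<le> 1" and s: "2 \<le> s"
  shows "measure_pmf.prob (coins n p)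
           {b. s \<le> card (nbrs (coin_graph n b) v) \<and>
               (\<forall>u\<in>nbrs (coin_graph n b) v. \<forall>w\<in>nbrs (coin_graph n b) v. {u, w} \<notin> edges (coin_graph n b))}
         \<le> exp (- (p * s\<^sup>2 / 4))"
proof -
  let ?P = "measure_pmf.prob (coins n p)"
  define \<S> where "\<S> = {S. S \<subseteq> {..<n} - {v} \<and> s \<le> card S}"
  define N where "N S = {b. nbrs (coin_graph n b) v = S}" for S
  define pairs where "pairs S = {e. e \<subseteq> S \<and> card e = 2}" for S :: "nat set"
  define Q where "Q S = {b. \<forall>e\<in>pairs S. b e = False}" for S
  have fin: "finite \<S>" by (rule finite_subset[of _ "Pow {..<n}"]) (auto simp: \<S>_def)
  have sub: "{b. s \<le> card (nbrs (coin_graph n b) v) \<and>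
      (\<forall>u\<in>nbrs (coin_graph n b) v. \<forall>w\<in>nbrs (coin_graph n b) v. {u, w} \<notin> edges (coin_graph n b))}
      \<subseteq> (\<Union>S\<in>\<S>. N S \<inter> Q S)"
  proof safe
    fix b
    let ?S = "nbrs (coin_graph n b) v"
    assume b: "s \<le> card ?S" "\<forall>u\<in>?S. \<forall>w\<in>?S. {u, w} \<notin> edges (coin_graph n b)"
    have Sn: "?S \<subseteq> {..<n} - {v}" using v by (auto simp: nbrs_coin_graph)
    have "b \<in> Q ?S"
      unfolding Q_def pairs_def
    proof safe
      fix e assume e: "e \<subseteq> ?S" "card e = 2" "b e"
      then obtain u w where uw: "e = {u, w}" by (auto simp: card_2_iff)
      have "e \<in> vertex_pairs n" using e Sn by (auto simp: vertex_pairs_def)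
      hence "{u, w} \<in> edges (coin_graph n b)" using e uw by (simp add: coin_graph_def)
      thus False using b(2) e(1) uw by auto
    qed
    thus "b \<in> (\<Union>S\<in>\<S>. N S \<inter> Q S)" using b(1) Sn by (auto simp: \<S>_def N_def)
  qed
  have PQ: "?P (Q S) \<le> exp (- (p * s\<^sup>2 / 4))" if S: "S \<in> \<S>" for S
  proof -
    have S': "S \<subseteq> {..<n}" "s \<le> card S" "finite S"
      using S by (auto simp: \<S>_def intro: finite_subset)
    have "?P (Q S) = (1 - p) ^ card (pairs S)"
      unfolding Q_def using S'
      by (subst prob_all_heads[OF finite_vertex_pairs _ p]) (auto simp: pairs_def vertex_pairs_def)
    also have "card (pairs S) = card S choose 2" unfolding pairs_def by (rule n_subsets[OF S'(3)])
    also have "(1 - p) ^ (card S choose 2) \<le> exp (- p) ^ (card S choose 2)"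
      using p exp_ge_add_one_self[of "- p"] by (intro power_mono) auto
    also have "\<dots> = exp (- (p * real (card S choose 2)))"
      by (simp add: exp_of_nat_mult[symmetric] mult.commute)
    also have "\<dots> \<le> exp (- (p * (s\<^sup>2 / 4)))"
    proof -
      \<comment> \<open>\<open>s / 2 \<le> card S - 1\<close> because \<open>s \<ge> 2\<close>.\<close>
      have "s\<^sup>2 / 4 = s * (s / 2) / 2" by (simp add: power2_eq_square)
      also have "\<dots> \<le> real (card S) * (real (card S) - 1) / 2"
        using S' s by (intro divide_right_mono mult_mono) auto
      also have "\<dots> = real (card S choose 2)"
      proof -
        have "even (card S * (card S - 1))" by (cases "card S") auto
        moreover have "1 \<le> card S" using S' s by linarith
        ultimately show ?thesis by (simp add: choose_two real_of_nat_div of_nat_diff)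
      qed
      finally have "p * (s\<^sup>2 / 4) \<le> p * real (card S choose 2)" using p by (intro mult_left_mono)
      thus ?thesis by simp
    qed
    finally show ?thesis by simp
  qed
  have indep: "?P (N S \<inter> Q S) = ?P (N S) * ?P (Q S)" if S: "S \<in> \<S>" for S
  proof (rule prob_Pi_pmf_Int[OF finite_vertex_pairs star_pairs(1)[OF v]])
    show "star_pairs n v \<inter> pairs S = {}"
      using S by (auto simp: star_pairs_def pairs_def \<S>_def)
    show "determined_by (N S) (star_pairs n v)"
      unfolding determined_by_def
    proof (intro allI impI)
      fix f g assume fg: "\<forall>x\<in>star_pairs n v. f x = g x" "f \<in> N S"
      hence "nbrs (coin_graph n g) v = nbrs (coin_graph n f) v"
        using v by (auto simp: nbrs_coin_graph star_pairs_def)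
      thus "g \<in> N S" using fg by (simp add: N_def)
    qed
    show "determined_by (Q S) (pairs S)" by (auto simp: determined_by_def Q_def)
  qed
  have "?P {b. s \<le> card (nbrs (coin_graph n b) v) \<and>
      (\<forall>u\<in>nbrs (coin_graph n b) v. \<forall>w\<in>nbrs (coin_graph n b) v. {u, w} \<notin> edges (coin_graph n b))}
      \<le> ?P (\<Union>S\<in>\<S>. N S \<inter> Q S)"
    using sub by (intro measure_pmf.finite_measure_mono) auto
  also have "\<dots> \<le> (\<Sum>S\<in>\<S>. ?P (N S \<inter> Q S))"
    using fin by (intro measure_pmf.finite_measure_subadditive_finite) auto
  also have "\<dots> \<le> (\<Sum>S\<in>\<S>. ?P (N S) * exp (- (p * s\<^sup>2 / 4)))"
    by (intro sum_mono) (simp add: indep PQ mult_left_mono)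
  also have "\<dots> = (\<Sum>S\<in>\<S>. ?P (N S)) * exp (- (p * s\<^sup>2 / 4))" by (simp add: sum_distrib_right)
  also have "(\<Sum>S\<in>\<S>. ?P (N S)) = ?P (\<Union>S\<in>\<S>. N S)"
    using fin by (intro measure_pmf.finite_measure_finite_Union[symmetric])
      (auto simp: disjoint_family_on_def N_def)
  also have "\<dots> * exp (- (p * s\<^sup>2 / 4)) \<le> 1 * exp (- (p * s\<^sup>2 / 4))"
    by (intro mult_right_mono) auto
  finally show ?thesis by simp
qed

lemma prob_some_independent_neighbourhood:
  fixes p :: real
  assumes n: "1 \<le> n" and p: "p \<le> 1" "real n powr (- 3 / 5) \<le> p"
    and big: "20 \<le> n * p"
  shows "measure_pmf.prob (coins n p)
           {b. \<exists>v<n. n * p / 10 \<le> card (nbrs (coin_graph n b) v) \<and>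
               (\<forall>u\<in>nbrs (coin_graph n b) v. \<forall>w\<in>nbrs (coin_graph n b) v. {u, w} \<notin> edges (coin_graph n b))}
         \<le> n * exp (- (real n powr (1 / 5) / 400))"
proof -
  let ?A = "\<lambda>v. {b. n * p / 10 \<le> card (nbrs (coin_graph n b) v) \<and>
               (\<forall>u\<in>nbrs (coin_graph n b) v. \<forall>w\<in>nbrs (coin_graph n b) v. {u, w} \<notin> edges (coin_graph n b))}"
  have p0: "0 \<le> p" using p(2) by (rule order_trans[rotated]) simp
  have "measure_pmf.prob (coins n p) (?A v) \<le> exp (- (real n powr (1 / 5) / 400))" if v: "v < n" for v
  proof -
    have "measure_pmf.prob (coins n p) (?A v) \<le> exp (- (p * (n * p / 10)\<^sup>2 / 4))"
      using p0 p big by (intro prob_independent_neighbourhood v) auto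
    also have "\<dots> \<le> exp (- (real n powr (1 / 5) / 400))"
    proof -
      have "real n powr (1 / 5) = real n powr 2 * (real n powr (- 3 / 5)) ^ 3"
      proof -
        have "(real n powr (- 3 / 5)) ^ 3 = real n powr (- 9 / 5)" using n by (simp add: powr_power)
        thus ?thesis using powr_add[of "real n" 2 "- 9 / 5"] by simp
      qed
      also have "\<dots> = (real n)\<^sup>2 * (real n powr (- 3 / 5)) ^ 3" using n by simp
      also have "\<dots> \<le> (real n)\<^sup>2 * p ^ 3" using p by (intro mult_left_mono power_mono) auto
      finally show ?thesis by (simp add: power2_eq_square power3_eq_cube field_simps)
    qed
    finally show ?thesis .
  qed
  note single = this
  have "measure_pmf.prob (coins n p) (\<Union>v\<in>{..<n}. ?A v)
      \<le> card {..<n} * exp (- (real n powr (1 / 5) / 400))"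
    by (rule prob_UN_le) (use single in auto)
  also have "(\<Union>v\<in>{..<n}. ?A v) = {b. \<exists>v<n. b \<in> ?A v}" by auto
  finally show ?thesis by simp
qed

section \<open>The two ranges of the edge probability\<close>

lemma prob_ch2_le_ch_add_sparse:
  fixes n :: nat and p :: real
  defines "D \<equiv> 8 * (n * p)"
  assumes n: "10 \<le> n" and p: "6 * ln (real n) / n < p" "p \<le> 1" "p \<le> real n powr (- 3 / 5)"
    and D: "64 \<le> D" "4 * (real 14 + 1) * (ln D)\<^sup>2 \<le> 3 * sqrt D" "5121 \<le> 8 * D / ln D"
  shows "1 - 3 / n \<le> measure_pmf.prob (random_graph n p) {G. ch2 G \<le> ch G + 5120}"
proof -
  let ?P = "measure_pmf.prob (coins n p)" and ?N = "\<lambda>b. nbrs (coin_graph n b)"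
  let ?A = "{b. \<exists>v<n. 8 * (n * p) < card (?N b v)}" and ?B = "{b. \<exists>v<n. card (?N b v) < n * p / 10}"
    and ?C = "{b. \<exists>u<n. \<exists>v<n. u \<noteq> v \<and> 15 \<le> card (?N b u \<inter> ?N b v)}"
  let ?good = "{b. ch2 (coin_graph n b) \<le> ch (coin_graph n b) + 5120}"
  have "0 < 6 * ln (real n) / n" using n by simp
  hence p0: "0 \<le> p" using p by linarith
  have "b \<in> ?good" if b: "b \<notin> ?A" "b \<notin> ?B" "b \<notin> ?C" for b
  proof -
    have V: "verts (coin_graph n b) = {..<n}" by (simp add: coin_graph_def)
    have "ch2 (coin_graph n b) \<le> ch (coin_graph n b) + 5120"
    proof (rule ch2_le_ch_add[OF simple_graph_coin_graph _ _ _ D])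
      fix v assume v: "v \<in> verts (coin_graph n b)"
      have "\<not> card (?N b v) < n * p / 10" using b(2) v by (auto simp: V)
      thus "D / 80 \<le> card (?N b v)" unfolding D_def by linarith
      have "\<not> D < card (?N b v)" using b(1) v by (auto simp: V D_def)
      thus "card (?N b v) \<le> D" by simp
      show "card (?N b u \<inter> ?N b v) \<le> 14" if u: "u \<in> ?N b v" for u
      proof -
        have "u < n" "v < n" "u \<noteq> v" using u v by (auto simp: V nbrs_coin_graph)
        hence "\<not> 15 \<le> card (?N b u \<inter> ?N b v)" using b(3) by blast
        thus ?thesis by linarith
      qed
    qed
    thus ?thesis by simp
  qed
  hence "UNIV \<subseteq> ?good \<union> (?A \<union> (?B \<union> ?C))" by blast
  hence "?P UNIV \<le> ?P (?good \<union> (?A \<union> (?B \<union> ?C)))" by (intro measure_pmf.finite_measure_mono) auto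
  also have "\<dots> \<le> ?P ?good + (?P ?A + (?P ?B + ?P ?C))"
    by (intro order_trans[OF measure_Un_le] add_left_mono) auto
  also have "\<dots> \<le> ?P ?good + (1 / n + (1 / n + 1 / n))"
    using n p p0
    by (intro add_left_mono add_mono prob_large_degree prob_small_degree prob_large_codegree) auto
  finally show ?thesis by (simp add: prob_random_graph)
qed

lemma prob_ch2_le_ch_add_dense:
  fixes p :: real
  assumes n: "10 \<le> n" and p: "6 * ln (real n) / n < p" "p \<le> 1" "real n powr (- 3 / 5) \<le> p"
    and big: "20 \<le> n * p"
  shows "1 - 1 / n - n * exp (- (real n powr (1 / 5) / 400))
         \<le> measure_pmf.prob (random_graph n p) {G. ch2 G \<le> ch G + 1}"
proof -
  let ?P = "measure_pmf.prob (coins n p)" and ?N = "\<lambda>b. nbrs (coin_graph n b)"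
  let ?A = "{b. \<exists>v<n. card (?N b v) < n * p / 10}"
    and ?B = "{b. \<exists>v<n. n * p / 10 \<le> card (?N b v) \<and>
       (\<forall>u\<in>?N b v. \<forall>w\<in>?N b v. {u, w} \<notin> edges (coin_graph n b))}"
  let ?good = "{b. ch2 (coin_graph n b) \<le> ch (coin_graph n b) + 1}"
  have "b \<in> ?good" if b: "b \<notin> ?A" "b \<notin> ?B" for b
  proof -
    have V: "verts (coin_graph n b) = {..<n}" by (simp add: coin_graph_def)
    have "ch2 (coin_graph n b) \<le> ch (coin_graph n b) + 1"
    proof (rule ch2_le_ch_add_if_triangle_at_each_vertex[OF simple_graph_coin_graph])
      fix v assume "v \<in> verts (coin_graph n b)"
      hence "v < n" by (simp add: V)
      moreover from this have "n * p / 10 \<le> card (?N b v)"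
        using b(1) by (force simp del: divide_le_eq_numeral1 simp: not_less)
      ultimately show "\<exists>u\<in>?N b v. \<exists>w\<in>?N b v. {u, w} \<in> edges (coin_graph n b)" using b(2) by blast
    qed
    thus ?thesis by simp
  qed
  hence "UNIV \<subseteq> ?good \<union> (?A \<union> ?B)" by blast
  hence "?P UNIV \<le> ?P (?good \<union> (?A \<union> ?B))" by (intro measure_pmf.finite_measure_mono) auto
  also have "\<dots> \<le> ?P ?good + (?P ?A + ?P ?B)"
    by (intro order_trans[OF measure_Un_le] add_left_mono) auto
  also have "\<dots> \<le> ?P ?good + (1 / n + n * exp (- (real n powr (1 / 5) / 400)))"
    using n p big
    by (intro add_left_mono add_mono prob_small_degree prob_some_independent_neighbourhood) auto
  finally show ?thesis by (simp add: prob_random_graph)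
qed

theorem corollary4p3:
  shows "\<exists>C::nat. \<forall>p::nat \<Rightarrow> real.
           (\<forall>\<^sub>F n in sequentially. 6 * ln (real n) / real n < p n \<and> p n \<le> 1) \<longrightarrow>
           (\<lambda>n. measure_pmf.prob (random_graph n (p n)) {G. ch2 G \<le> ch G + C}) \<longlonglongrightarrow> 1"
proof (intro exI[of _ 5120] allI impI)
  fix p :: "nat \<Rightarrow> real"
  assume p: "\<forall>\<^sub>F n in sequentially. 6 * ln (real n) / real n < p n \<and> p n \<le> 1"
  let ?P = "\<lambda>n. measure_pmf.prob (random_graph n (p n)) {G. ch2 G \<le> ch G + 5120}"
  define \<epsilon> where "\<epsilon> n = 3 / real n + real n * exp (- (real n powr (1 / 5) / 400))" for n
  have "\<forall>\<^sub>F D :: real in at_top. 160 \<le> D \<and> 4 * (real 14 + 1) * (ln D)\<^sup>2 \<le> 3 * sqrt D \<and> 5121 \<le> 8 * D / ln D"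
    by (intro eventually_conj eventually_ge_at_top) real_asymp+
  then obtain D0 where D0: "160 \<le> D \<and> 4 * (real 14 + 1) * (ln D)\<^sup>2 \<le> 3 * sqrt D \<and> 5121 \<le> 8 * D / ln D"
    if "D0 \<le> D" for D :: real
    unfolding eventually_at_top_linorder by blast
  \<comment> \<open>Since \<open>np > 6 ln n\<close>, the degree bound \<open>8np\<close> exceeds \<open>48 ln n\<close> and tends to infinity. The
      condition \<open>160 \<le> 8np\<close> makes \<open>np / 10 \<ge> 2\<close>, as the dense range requires.\<close>
  have "\<forall>\<^sub>F n in sequentially. D0 \<le> 48 * ln (real n)"
    by real_asymp
  hence "\<forall>\<^sub>F n in sequentially. 1 - \<epsilon> n \<le> ?P n"
    using p eventually_ge_at_top[of "10 :: nat"]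
  proof eventually_elim
    case (elim n)
    hence n: "10 \<le> n" and pn: "6 * ln (real n) / n < p n" "p n \<le> 1" by auto
    have "48 * ln (real n) \<le> 8 * (n * p n)" using pn(1) n by (simp add: field_simps)
    hence D: "160 \<le> 8 * (n * p n) \<and> 4 * (real 14 + 1) * (ln (8 * (n * p n)))\<^sup>2 \<le> 3 * sqrt (8 * (n * p n)) \<and>
        5121 \<le> 8 * (8 * (n * p n)) / ln (8 * (n * p n))"
      using elim by (intro D0) linarith
    show ?case
    proof (cases "p n \<le> real n powr (- 3 / 5)")
      case True
      have "1 - 3 / n \<le> ?P n"
        using D by (intro prob_ch2_le_ch_add_sparse n pn True) auto
      moreover have "0 \<le> real n * exp (- (real n powr (1 / 5) / 400))" by simp
      ultimately show ?thesis unfolding \<epsilon>_def by linarith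
    next
      case False
      have "1 - 1 / n - n * exp (- (real n powr (1 / 5) / 400))
          \<le> measure_pmf.prob (random_graph n (p n)) {G. ch2 G \<le> ch G + 1}"
        using D False by (intro prob_ch2_le_ch_add_dense n pn) auto
      also have "\<dots> \<le> ?P n" by (intro measure_pmf.finite_measure_mono) auto
      moreover have "1 / real n \<le> 3 / real n" by (simp add: divide_right_mono)
      ultimately show ?thesis unfolding \<epsilon>_def by linarith
    qed
  qed
  moreover have "(\<lambda>n. 1 - \<epsilon> n) \<longlonglongrightarrow> 1" unfolding \<epsilon>_def by real_asymp
  moreover have "\<forall>\<^sub>F n in sequentially. ?P n \<le> 1" by simp
  ultimately show "?P \<longlonglongrightarrow> 1"
    by (intro tendsto_sandwich[OF _ _ _ tendsto_const, of "\<lambda>n. 1 - \<epsilon> n" ?P sequentially 1]) auto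
qed

end
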